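(* Let $S_{1,1}$ be a surface of genus one with one puncture, let $a,b$ be standard generators of the free group $\pi_1(S_{1,1})=F(a,b)$, and let $g$ be the point of the Teichmüller space $T_{1,1}$ of $S_{1,1}$ (unique) such that $\mathrm{Tr}_g(a)=\mathrm{Tr}_g(b)$ and $\mathrm{Tr}_g(a^2)=\mathrm{Tr}_g(a^2b)$. Then the metric $g$ is non-arithmetic.
   Context: $T_{1,1}$ is the space of complete finite-area hyperbolic metrics on $S_{1,1}$ up to isotopy. For $\gamma\in\pi_1(S_{1,1})$, $\ell_g(\gamma)$ is the length of the closed geodesic freely homotopic to $\gamma$ ($0$ if $\gamma$ is parabolic or trivial) and $\mathrm{Tr}_g(\gamma)=2\cosh(\ell_g(\gamma)/2)$. Standard generators $a,b$ are free generators whose commutator represents a loop around the puncture. Arithmeticity: let $k$ be a totally real number field and $A$ a quaternion algebra over $k$ which is unramified at exactly one real place (the identity embedding) and ramified at all the other real places, so that $A\otimes_{\mathbb{Q}}\mathbb{R}\cong M_2(\mathbb{R})\oplus\mathbf{H}\oplus\cdots\oplus\mathbf{H}$, with $\mathbf{H}$ Hamilton's quaternions. For an order $\mathcal{O}$ in $A$, let $\mathcal{O}^1$ be its group of elements of reduced norm $1$; its image in $\operatorname{PSL}(2,\mathbb{R})$ under projection to the first factor is a lattice. A Fuchsian lattice is arithmetic if it is commensurable (up to conjugation) with such an image. A hyperbolic metric is arithmetic if the Fuchsian lattice in $\operatorname{PSL}(2,\mathbb{R})$ given by the fundamental group is arithmetic. (Non-uniform arithmetic Fuchsian lattices are exactly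 those commensurable, up to conjugation, with $\operatorname{PSL}(2,\mathbb{Z})$.) *)

theory Defs
  imports
    "HOL-Analysis.Analysis"
    "HOL-Algebra.Coset"
    "HOL-Algebra.Generated_Groups"
    "HOL-Computational_Algebra.Polynomial"
begin

section \<open>The group PSL(2,R) and the hyperbolic plane\<close>

definition SL2R :: "(real^2^2) monoid" where
  "SL2R = \<lparr>carrier = {M. det M = 1}, monoid.mult = (**), one = mat 1\<rparr>"

definition PSL2R :: "(real^2^2) set monoid" where
  "PSL2R = SL2R Mod {mat 1, - mat 1}"

definition to_PSL2R :: "real^2^2 \<Rightarrow> (real^2^2) set" where
  "to_PSL2R M = {mat 1, - mat 1} #>\<^bsub>SL2R\<^esub> M"

definition upper_half_plane :: "complex set" where
  "upper_half_plane = {z. Im z > 0}"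

definition moebius :: "real^2^2 \<Rightarrow> complex \<Rightarrow> complex" where
  "moebius M z = (of_real (M$1$1) * z + of_real (M$1$2)) / (of_real (M$2$1) * z + of_real (M$2$2))"

text \<open>An element of \<^const>\<open>PSL2R\<close> is a coset consisting of \<open>M\<close> and \<open>- M\<close>, which act in the same way.\<close>

definition act :: "(real^2^2) set \<Rightarrow> complex \<Rightarrow> complex" where
  "act X z = the_elem ((\<lambda>M. moebius M z) ` X)"

definition parabolic :: "(real^2^2) set \<Rightarrow> bool" where
  "parabolic X \<longleftrightarrow> X \<noteq> \<one>\<^bsub>PSL2R\<^esub> \<and> (\<forall>M\<in>X. \<bar>trace M\<bar> = 2)"

definition hyp_dist :: "complex \<Rightarrow> complex \<Rightarrow> real" where
  "hyp_dist z w = arcosh (1 + (cmod (z - w))\<^sup>2 / (2 * Im z * Im w))"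

definition hyp_area :: "complex set \<Rightarrow> ennreal" where
  "hyp_area F = (\<integral>\<^sup>+ z. ennreal (1 / (Im z)\<^sup>2) * indicator F z \<partial>lborel)"

definition geodesic_line :: "(real \<Rightarrow> complex) \<Rightarrow> bool" where
  "geodesic_line c \<longleftrightarrow> range c \<subseteq> upper_half_plane \<and> (\<forall>s t. hyp_dist (c s) (c t) = \<bar>s - t\<bar>)"

section \<open>Complete hyperbolic metrics on surfaces\<close>

text \<open>A complete hyperbolic metric on an orientable surface \<open>S\<close> is given by its universal covering
  \<open>p\<close> from the hyperbolic plane onto \<open>S\<close>, whose deck group \<open>\<Gamma>\<close> consists of orientation-preserving
  isometries: the metric is the one that makes \<open>p\<close> a local isometry.\<close>

definition hyperbolic_uniformization ::
    "'s::topological_space set \<Rightarrow> (complex \<Rightarrow> 's) \<Rightarrow> (real^2^2) set set \<Rightarrow> bool" where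
  "hyperbolic_uniformization S p \<Gamma> \<longleftrightarrow>
     subgroup \<Gamma> PSL2R \<and> covering_space upper_half_plane p S \<and>
     (\<forall>z\<in>upper_half_plane. \<forall>w\<in>upper_half_plane. p z = p w \<longleftrightarrow> (\<exists>X\<in>\<Gamma>. w = act X z))"

text \<open>The infimum is attained at every strict Borel fundamental domain of the deck group.\<close>

definition surface_area :: "'s set \<Rightarrow> (complex \<Rightarrow> 's) \<Rightarrow> ennreal" where
  "surface_area S p = (INF F\<in>{F\<in>sets borel. F \<subseteq> upper_half_plane \<and> p ` F = S}. hyp_area F)"

text \<open>A closed geodesic of length \<open>L\<close> in the free homotopy class of the deck transformation \<open>X\<close>
  is the image under the covering of a geodesic line which \<open>X\<close> translates by \<open>L\<close>.\<close>

definition closed_geodesic_of_length :: "(real^2^2) set \<Rightarrow> real \<Rightarrow> bool" where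
  "closed_geodesic_of_length X L \<longleftrightarrow>
     L > 0 \<and> (\<exists>c. geodesic_line c \<and> (\<forall>t. act X (c t) = c (t + L)))"

definition geodesic_length :: "('g \<Rightarrow> (real^2^2) set) \<Rightarrow> 'g \<Rightarrow> real" where
  "geodesic_length \<rho> x =
     (if \<exists>L. closed_geodesic_of_length (\<rho> x) L then THE L. closed_geodesic_of_length (\<rho> x) L else 0)"

definition Tr :: "('g \<Rightarrow> (real^2^2) set) \<Rightarrow> 'g \<Rightarrow> real" where
  "Tr \<rho> x = 2 * cosh (geodesic_length \<rho> x / 2)"

section \<open>The once-punctured torus and its Teichmueller space\<close>

definition punctured_torus :: "(complex \<times> complex) set" where
  "punctured_torus = sphere 0 1 \<times> sphere 0 1 - {(1, 1)}"

text \<open>A letter \<open>(s, e)\<close> stands for \<open>a\<close> (if \<open>s\<close>) or \<open>b\<close> (if not \<open>s\<close>), inverted unless \<open>e\<close>.\<close>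

definition letter :: "('g, 'm) monoid_scheme \<Rightarrow> 'g \<Rightarrow> 'g \<Rightarrow> bool \<times> bool \<Rightarrow> 'g" where
  "letter G a b l =
     (let x = (if fst l then a else b) in if snd l then x else inv\<^bsub>G\<^esub> x)"

definition word_value :: "('g, 'm) monoid_scheme \<Rightarrow> 'g \<Rightarrow> 'g \<Rightarrow> (bool \<times> bool) list \<Rightarrow> 'g" where
  "word_value G a b w = foldr (\<lambda>l x. letter G a b l \<otimes>\<^bsub>G\<^esub> x) w \<one>\<^bsub>G\<^esub>"

definition reduced_word :: "(bool \<times> bool) list \<Rightarrow> bool" where
  "reduced_word w \<longleftrightarrow>
     (\<forall>i. Suc i < length w \<longrightarrow> \<not> (fst (w ! i) = fst (w ! Suc i) \<and> snd (w ! i) \<noteq> snd (w ! Suc i)))"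

definition free_generators :: "('g, 'm) monoid_scheme \<Rightarrow> 'g \<Rightarrow> 'g \<Rightarrow> bool" where
  "free_generators G a b \<longleftrightarrow>
     group G \<and> a \<in> carrier G \<and> b \<in> carrier G \<and> generate G {a, b} = carrier G \<and>
     (\<forall>w. reduced_word w \<and> w \<noteq> [] \<longrightarrow> word_value G a b w \<noteq> \<one>\<^bsub>G\<^esub>)"

definition commutator :: "('g, 'm) monoid_scheme \<Rightarrow> 'g \<Rightarrow> 'g \<Rightarrow> 'g" where
  "commutator G a b = a \<otimes>\<^bsub>G\<^esub> b \<otimes>\<^bsub>G\<^esub> inv\<^bsub>G\<^esub> a \<otimes>\<^bsub>G\<^esub> inv\<^bsub>G\<^esub> b"

text \<open>Points of the Teichmueller space of the once-punctured torus: \<open>G\<close> is its fundamental group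
  with standard generators \<open>a\<close>, \<open>b\<close>, and the holonomy \<open>\<rho>\<close> identifies \<open>G\<close> with the deck group of
  the universal covering \<open>p\<close> that carries a complete hyperbolic metric of finite area. For such a
  metric the loops around the puncture are those with parabolic holonomy. Isotopic metrics
  correspond to conjugate holonomies, so \<open>Tr\<close> and arithmeticity only depend on the isotopy class.\<close>

definition teichmueller_punctured_torus ::
    "('g, 'm) monoid_scheme \<Rightarrow> 'g \<Rightarrow> 'g \<Rightarrow> (complex \<Rightarrow> complex \<times> complex) \<Rightarrow>
     ('g \<Rightarrow> (real^2^2) set) \<Rightarrow> bool" where
  "teichmueller_punctured_torus G a b p \<rho> \<longleftrightarrow>
     free_generators G a b \<and>
     \<rho> \<in> hom G PSL2R \<and> inj_on \<rho> (carrier G) \<and>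
     hyperbolic_uniformization punctured_torus p (\<rho> ` carrier G) \<and>
     surface_area punctured_torus p < \<infinity> \<and>
     parabolic (\<rho> (commutator G a b))"

section \<open>Arithmetic Fuchsian groups\<close>

text \<open>Since one real place of the number field is singled out as the identity, the field is taken
  to be a subfield of the reals.\<close>

definition lin_comb :: "real set \<Rightarrow> 'v::real_vector set \<Rightarrow> 'v set" where
  "lin_comb R B = {\<Sum>v\<in>B. c v *\<^sub>R v | c. \<forall>v\<in>B. c v \<in> R}"

definition real_number_field :: "real set \<Rightarrow> bool" where
  "real_number_field k \<longleftrightarrow>
     1 \<in> k \<and> (\<forall>x\<in>k. \<forall>y\<in>k. x - y \<in> k \<and> x * y \<in> k) \<and> (\<forall>x\<in>k. inverse x \<in> k) \<and>
     (\<exists>B. finite B \<and> k = lin_comb \<rat> B)"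

definition field_embedding :: "real set \<Rightarrow> (real \<Rightarrow> 'b::field) \<Rightarrow> bool" where
  "field_embedding k \<sigma> \<longleftrightarrow>
     \<sigma> 1 = 1 \<and> (\<forall>x\<in>k. \<forall>y\<in>k. \<sigma> (x + y) = \<sigma> x + \<sigma> y \<and> \<sigma> (x * y) = \<sigma> x * \<sigma> y)"

definition totally_real :: "real set \<Rightarrow> bool" where
  "totally_real k \<longleftrightarrow> (\<forall>\<sigma>::real \<Rightarrow> complex. field_embedding k \<sigma> \<longrightarrow> \<sigma> ` k \<subseteq> \<real>)"

definition integers_of :: "real set \<Rightarrow> real set" where
  "integers_of k = {x\<in>k. algebraic_int x}"

text \<open>The quaternion algebra \<open>(\<alpha>, \<beta> / \<real>)\<close> with basis \<open>1, i, j, ij\<close>, where \<open>i\<^sup>2 = \<alpha>\<close>,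
  \<open>j\<^sup>2 = \<beta>\<close> and \<open>ji = - ij\<close>. For \<open>\<alpha>, \<beta>\<close> in \<open>k\<close> the elements with coordinates in \<open>k\<close> form the
  quaternion algebra \<open>(\<alpha>, \<beta> / k)\<close>, and every quaternion algebra over \<open>k\<close> is of this form. Its base
  change along a real place \<open>\<sigma>\<close> is \<open>(\<sigma> \<alpha>, \<sigma> \<beta> / \<real>)\<close>.\<close>

definition quat_mult :: "real \<Rightarrow> real \<Rightarrow> real^4 \<Rightarrow> real^4 \<Rightarrow> real^4" where
  "quat_mult \<alpha> \<beta> x y = vector
     [x$1 * y$1 + \<alpha> * (x$2 * y$2) + \<beta> * (x$3 * y$3) - \<alpha> * \<beta> * (x$4 * y$4),
      x$1 * y$2 + x$2 * y$1 - \<beta> * (x$3 * y$4) + \<beta> * (x$4 * y$3),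
      x$1 * y$3 + x$3 * y$1 + \<alpha> * (x$2 * y$4) - \<alpha> * (x$4 * y$2),
      x$1 * y$4 + x$4 * y$1 + x$2 * y$3 - x$3 * y$2]"

definition quat_one :: "real^4" where
  "quat_one = vector [1, 0, 0, 0]"

definition quat_norm :: "real \<Rightarrow> real \<Rightarrow> real^4 \<Rightarrow> real" where
  "quat_norm \<alpha> \<beta> x = (x$1)\<^sup>2 - \<alpha> * (x$2)\<^sup>2 - \<beta> * (x$3)\<^sup>2 + \<alpha> * \<beta> * (x$4)\<^sup>2"

definition quat_alg :: "real set \<Rightarrow> (real^4) set" where
  "quat_alg k = {x. \<forall>n. x$n \<in> k}"

definition split_iso :: "real \<Rightarrow> real \<Rightarrow> (real^4 \<Rightarrow> real^2^2) \<Rightarrow> bool" where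
  "split_iso \<alpha> \<beta> \<phi> \<longleftrightarrow>
     linear \<phi> \<and> bij \<phi> \<and> \<phi> quat_one = mat 1 \<and> (\<forall>x y. \<phi> (quat_mult \<alpha> \<beta> x y) = \<phi> x ** \<phi> y)"

definition hamilton_iso :: "real \<Rightarrow> real \<Rightarrow> (real^4 \<Rightarrow> real^4) \<Rightarrow> bool" where
  "hamilton_iso \<alpha> \<beta> \<psi> \<longleftrightarrow>
     linear \<psi> \<and> bij \<psi> \<and> \<psi> quat_one = quat_one \<and>
     (\<forall>x y. \<psi> (quat_mult \<alpha> \<beta> x y) = quat_mult (-1) (-1) (\<psi> x) (\<psi> y))"

text \<open>Real places of \<open>k\<close> are compared with the identity on \<open>k\<close> only; the values of \<open>\<sigma>\<close> outside
  \<open>k\<close> are irrelevant.\<close>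

definition ramified_at_other_places :: "real set \<Rightarrow> real \<Rightarrow> real \<Rightarrow> bool" where
  "ramified_at_other_places k \<alpha> \<beta> \<longleftrightarrow>
     (\<forall>\<sigma>::real \<Rightarrow> real. field_embedding k \<sigma> \<and> (\<exists>x\<in>k. \<sigma> x \<noteq> x) \<longrightarrow>
        (\<exists>\<psi>. hamilton_iso (\<sigma> \<alpha>) (\<sigma> \<beta>) \<psi>))"

text \<open>An order is a subring that is a full lattice, i.e. finitely generated over the ring of
  integers of \<open>k\<close> and spanning the algebra over \<open>k\<close>.\<close>

definition quat_order :: "real set \<Rightarrow> real \<Rightarrow> real \<Rightarrow> (real^4) set \<Rightarrow> bool" where
  "quat_order k \<alpha> \<beta> \<O> \<longleftrightarrow>
     quat_one \<in> \<O> \<and> (\<forall>x\<in>\<O>. \<forall>y\<in>\<O>. quat_mult \<alpha> \<beta> x y \<in> \<O>) \<and>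
     (\<exists>B. finite B \<and> \<O> = lin_comb (integers_of k) B \<and> quat_alg k = lin_comb k B)"

definition norm_one_image :: "real \<Rightarrow> real \<Rightarrow> (real^4 \<Rightarrow> real^2^2) \<Rightarrow> (real^4) set \<Rightarrow> (real^2^2) set set" where
  "norm_one_image \<alpha> \<beta> \<phi> \<O> = (\<lambda>x. to_PSL2R (\<phi> x)) ` {x\<in>\<O>. quat_norm \<alpha> \<beta> x = 1}"

definition finite_index :: "('g, 'm) monoid_scheme \<Rightarrow> 'g set \<Rightarrow> 'g set \<Rightarrow> bool" where
  "finite_index G K H \<longleftrightarrow> finite (rcosets\<^bsub>G\<lparr>carrier := H\<rparr>\<^esub> K)"

definition commensurable :: "('g, 'm) monoid_scheme \<Rightarrow> 'g set \<Rightarrow> 'g set \<Rightarrow> bool" where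
  "commensurable G H K \<longleftrightarrow> finite_index G (H \<inter> K) H \<and> finite_index G (H \<inter> K) K"

definition conjugate_set :: "('g, 'm) monoid_scheme \<Rightarrow> 'g \<Rightarrow> 'g set \<Rightarrow> 'g set" where
  "conjugate_set G h H = (\<lambda>x. h \<otimes>\<^bsub>G\<^esub> x \<otimes>\<^bsub>G\<^esub> inv\<^bsub>G\<^esub> h) ` H"

definition arithmetic :: "(real^2^2) set set \<Rightarrow> bool" where
  "arithmetic \<Gamma> \<longleftrightarrow>
     (\<exists>k \<alpha> \<beta> \<phi> \<O>. real_number_field k \<and> totally_real k \<and>
        \<alpha> \<in> k - {0} \<and> \<beta> \<in> k - {0} \<and>
        split_iso \<alpha> \<beta> \<phi> \<and> ramified_at_other_places k \<alpha> \<beta> \<and> quat_order k \<alpha> \<beta> \<O> \<and>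
        (\<exists>h\<in>carrier PSL2R.
           commensurable PSL2R \<Gamma> (conjugate_set PSL2R h (norm_one_image \<alpha> \<beta> \<phi> \<O>))))"

end

theory Submission
  imports Defs "HOL-Computational_Algebra.Fundamental_Theorem_Algebra"
begin

text \<open>Lift the holonomies of \<open>a\<close> and \<open>b\<close> to matrices \<open>A\<close>, \<open>B\<close> of nonnegative trace and put
  \<open>x = tr A\<close>, \<open>y = tr B\<close>, \<open>z = tr AB\<close>. The commutator has trace \<open>- 2\<close>, since trace \<open>2\<close> would make
  \<open>A\<close>, \<open>B\<close> generate a solvable group; hence \<open>x\<^sup>2 + y\<^sup>2 + z\<^sup>2 = x y z\<close> with \<open>x, y, z > 2\<close>, and the two
  length conditions become \<open>x = y\<close> and \<open>x\<^sup>2 - 2 = x (z - 1)\<close>. Eliminating \<open>z\<close> shows that \<open>x\<close> is a root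
  of a monic integral quintic without rational roots.

  If the lattice were arithmetic, the parabolic commutator would make the quaternion algebra
  isotropic; it could not be ramified at any further real place, so \<open>k = \<rat>\<close>. Suitable powers of \<open>A\<close>,
  \<open>B\<close>, \<open>AB\<close> lie in a \<open>\<rat>\<close>-algebra of matrices with rational traces, and comparing the trace-free parts
  of \<open>A\<close>, \<open>B\<close> and \<open>AB\<close> shows that \<open>x\<^sup>2\<close> and \<open>x y z\<close> are rational. Together with the two equations this
  makes \<open>x\<close> rational.\<close>

section \<open>Nontrivial embeddings of number fields\<close>

text \<open>Inverses are left out so that the polynomial values at any real number again form such a
  ring. For algebraic elements they are recovered in \<open>inverse_in_subalgebra\<close>.\<close>

definition rat_subalgebra :: "real set \<Rightarrow> bool" where
  "rat_subalgebra F \<longleftrightarrow> \<rat> \<subseteq> F \<and> (\<forall>x\<in>F. \<forall>y\<in>F. x + y \<in> F \<and> x * y \<in> F)"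

definition polys_over :: "real set \<Rightarrow> real poly set" where
  "polys_over F = {f. \<forall>i. coeff f i \<in> F}"

definition adjoin :: "real set \<Rightarrow> real \<Rightarrow> real set" where
  "adjoin F \<theta> = (\<lambda>f. poly f \<theta>) ` polys_over F"

lemma rat_subalgebraD:
  assumes "rat_subalgebra F"
  shows "x \<in> \<rat> \<Longrightarrow> x \<in> F" "x \<in> F \<Longrightarrow> y \<in> F \<Longrightarrow> x + y \<in> F" "x \<in> F \<Longrightarrow> y \<in> F \<Longrightarrow> x * y \<in> F"
    "0 \<in> F" "1 \<in> F" "x \<in> F \<Longrightarrow> - x \<in> F" "x \<in> F \<Longrightarrow> y \<in> F \<Longrightarrow> x - y \<in> F"
proof -
  show "x \<in> \<rat> \<Longrightarrow> x \<in> F" and a: "x \<in> F \<Longrightarrow> y \<in> F \<Longrightarrow> x + y \<in> F"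
    and "x \<in> F \<Longrightarrow> y \<in> F \<Longrightarrow> x * y \<in> F" "0 \<in> F" "1 \<in> F" for x y
    using assms by (auto simp: rat_subalgebra_def)
  have m: "- x \<in> F" if "x \<in> F" for x
  proof -
    have "(-1) * x \<in> F"
      using assms that by (metis Rats_1 Rats_minus_iff rat_subalgebra_def subsetD)
    then show ?thesis by simp
  qed
  then show "x \<in> F \<Longrightarrow> - x \<in> F" .
  show "x \<in> F \<Longrightarrow> y \<in> F \<Longrightarrow> x - y \<in> F"
    using a[of x "- y"] m[of y] by simp
qed

lemma rat_subalgebra_sum:
  assumes "rat_subalgebra F" "\<And>i. i \<in> I \<Longrightarrow> f i \<in> F"
  shows "sum f I \<in> F"
  using assms(2) by (induction I rule: infinite_finite_induct)
    (auto intro: rat_subalgebraD[OF assms(1)])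

lemma polys_over_closed:
  assumes F: "rat_subalgebra F"
  shows "f \<in> polys_over F \<Longrightarrow> g \<in> polys_over F \<Longrightarrow> f + g \<in> polys_over F"
    "f \<in> polys_over F \<Longrightarrow> g \<in> polys_over F \<Longrightarrow> f - g \<in> polys_over F"
    "f \<in> polys_over F \<Longrightarrow> g \<in> polys_over F \<Longrightarrow> f * g \<in> polys_over F"
    "c \<in> F \<Longrightarrow> f \<in> polys_over F \<Longrightarrow> smult c f \<in> polys_over F"
    "c \<in> F \<Longrightarrow> f \<in> polys_over F \<Longrightarrow> pCons c f \<in> polys_over F"
    "c \<in> F \<Longrightarrow> monom c n \<in> polys_over F"
    "f \<in> polys_over F \<Longrightarrow> pderiv f \<in> polys_over F"
    "0 \<in> polys_over F"
proof -
  note d = rat_subalgebraD[OF F]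
  show "f \<in> polys_over F \<Longrightarrow> pderiv f \<in> polys_over F"
  proof -
    have "of_nat n \<in> F" for n by (rule d(1)) simp
    then show "f \<in> polys_over F \<Longrightarrow> pderiv f \<in> polys_over F"
      by (auto simp: polys_over_def coeff_pderiv simp del: of_nat_Suc intro!: d(3))
  qed
qed (auto simp: polys_over_def coeff_mult coeff_pCons intro!: rat_subalgebraD(2-7)[OF F]
      rat_subalgebra_sum[OF F] split: nat.split)

lemma poly_in_subalgebra:
  assumes F: "rat_subalgebra F" and "f \<in> polys_over F" "x \<in> F"
  shows "poly f x \<in> F"
  using assms(2)
proof (induction f)
  case 0
  then show ?case using rat_subalgebraD(4)[OF F] by simp
next
  case (pCons c f)
  have "coeff (pCons c f) 0 \<in> F" "\<And>i. coeff (pCons c f) (Suc i) \<in> F"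
    using pCons.prems unfolding polys_over_def by blast+
  then show ?case
    using pCons.IH by (auto simp: polys_over_def assms(3) intro!: rat_subalgebraD(2-7)[OF F])
qed

lemma rat_subalgebra_adjoin:
  assumes F: "rat_subalgebra F"
  shows "rat_subalgebra (adjoin F \<theta>)" "F \<subseteq> adjoin F \<theta>" "\<theta> \<in> adjoin F \<theta>"
proof -
  note cl = polys_over_closed[OF F]
  show FA: "F \<subseteq> adjoin F \<theta>"
  proof
    fix c assume "c \<in> F"
    then show "c \<in> adjoin F \<theta>"
      by (auto simp: adjoin_def intro!: image_eqI[of _ _ "[:c:]"] cl)
  qed
  show "\<theta> \<in> adjoin F \<theta>"
    by (auto simp: adjoin_def intro!: image_eqI[of _ _ "[:0, 1:]"] cl rat_subalgebraD[OF F])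
  show "rat_subalgebra (adjoin F \<theta>)"
    unfolding rat_subalgebra_def
  proof (intro conjI ballI)
    show "\<rat> \<subseteq> adjoin F \<theta>"
      using FA F by (auto simp: rat_subalgebra_def)
    fix x y assume "x \<in> adjoin F \<theta>" "y \<in> adjoin F \<theta>"
    then obtain f g where fg: "x = poly f \<theta>" "y = poly g \<theta>" "f \<in> polys_over F" "g \<in> polys_over F"
      by (auto simp: adjoin_def)
    then show "x + y \<in> adjoin F \<theta>"
      by (auto simp: adjoin_def cl intro!: image_eqI[of _ _ "f + g"])
    show "x * y \<in> adjoin F \<theta>"
      using fg by (auto simp: adjoin_def cl intro!: image_eqI[of _ _ "f * g"])
  qed
qed

text \<open>Cancelling factors \<open>X\<close> from \<open>f\<close> leaves some
  \<open>c + X g\<close> with \<open>c\<close> nonzero that still vanishes at \<open>y\<close>; then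
  \<open>- g(y) / c\<close> is the inverse of \<open>y\<close>.\<close>

lemma inverse_in_subalgebra:
  assumes F: "rat_subalgebra F" and y: "y \<in> F" "y \<noteq> 0"
    and f: "f \<in> polys_over \<rat>" "f \<noteq> 0" "poly f y = 0"
  shows "inverse y \<in> F"
  using f
proof (induction f)
  case 0
  then show ?case by simp
next
  case (pCons c g)
  have c: "c \<in> \<rat>" and g: "g \<in> polys_over \<rat>"
  proof -
    have "coeff (pCons c g) 0 \<in> \<rat>" "\<And>i. coeff (pCons c g) (Suc i) \<in> \<rat>"
      using pCons.prems(1) unfolding polys_over_def by blast+
    then show "c \<in> \<rat>" "g \<in> polys_over \<rat>"
      by (simp_all add: polys_over_def)
  qed
  have "\<rat> \<subseteq> F"
    using F by (simp add: rat_subalgebra_def)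
  then have "g \<in> polys_over F"
    using g by (auto simp: polys_over_def)
  then have gy: "poly g y \<in> F"
    using poly_in_subalgebra F y by blast
  show ?case
  proof (cases "c = 0")
    case True
    then have "poly g y = 0" "g \<noteq> 0"
      using pCons.prems y by auto
    then show ?thesis using pCons.IH g by blast
  next
    case False
    then have "inverse y = - inverse c * poly g y"
      using pCons.prems(3) y by (simp add: field_simps)
    moreover have "- inverse c \<in> F"
      using c F by (simp add: rat_subalgebraD)
    ultimately show ?thesis
      using gy rat_subalgebraD(3)[OF F, of "- inverse c" "poly g y"] by simp
  qed
qed

section \<open>Algebraicity over the rationals and embeddings of simple extensions\<close>

interpretation rat_real: vector_space "\<lambda>q::rat. \<lambda>x::real. of_rat q * x"
  by standard (simp_all add: algebra_simps of_rat_add of_rat_mult)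

text \<open>The powers of \<open>y\<close> with exponents \<open>0\<close> to
  \<open>n = card B\<close> lie in the rational span of \<open>n\<close> reals, so they satisfy a
  linear relation over \<rat>, whose coefficients form \<open>f\<close>.\<close>

lemma powers_algebraic:
  fixes y :: real
  assumes B: "finite B" and pw: "\<And>i. y ^ i \<in> lin_comb \<rat> B"
  shows "\<exists>f. f \<in> polys_over \<rat> \<and> f \<noteq> 0 \<and> poly f y = 0"
proof -
  define n where "n = card B"
  have alg: "rat_subalgebra \<rat>" by (simp add: rat_subalgebra_def)
  note cl = polys_over_closed[OF alg]
  show ?thesis
  \<comment> \<open>The dependence argument sees the powers only as a set. A coincidence between two
    of them is a relation by itself, given by a difference of monomials.\<close>
  proof (cases "inj_on (\<lambda>i. y ^ i) {..n}")
    case False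
    then obtain i j where ij: "i \<noteq> j" "y ^ i = y ^ j"
      by (auto simp: inj_on_def)
    have "coeff (monom 1 i - monom 1 j :: real poly) i = 1"
      using ij by simp
    then have "monom 1 i - monom 1 j \<noteq> (0 :: real poly)" by force
    then show ?thesis
      using ij by (intro exI[of _ "monom 1 i - monom 1 j"]) (auto simp: poly_monom intro!: cl)
  next
    case True
    let ?S = "(\<lambda>i. y ^ i) ` {..n}"
    have "?S \<subseteq> rat_real.span B"
    proof
      fix x assume "x \<in> ?S"
      then obtain c where c: "x = (\<Sum>v\<in>B. c v *\<^sub>R v)" "\<forall>v\<in>B. c v \<in> \<rat>"
        using pw by (auto simp: lin_comb_def)
      have "c v *\<^sub>R v \<in> rat_real.span B" if v: "v \<in> B" for v
      proof -
        obtain q where "c v = of_rat q" using c(2) v by (meson Rats_cases)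
        then show ?thesis
          using v by (simp add: rat_real.span_base rat_real.span_scale)
      qed
      then show "x \<in> rat_real.span B"
        unfolding c by (rule rat_real.span_sum)
    qed
    moreover have "card ?S = Suc n"
      using True by (simp add: card_image)
    ultimately have "rat_real.dependent ?S"
      using rat_real.independent_span_bound[OF B, of ?S] by (auto simp: n_def)
    then obtain u where u: "(\<Sum>v\<in>?S. of_rat (u v) * v) = 0" "\<exists>v\<in>?S. u v \<noteq> 0"
      using rat_real.dependent_finite[of ?S] by auto
    define f where "f = (\<Sum>i\<le>n. monom (of_rat (u (y ^ i)) :: real) i)"
    have cf: "coeff f i = (if i \<le> n then of_rat (u (y ^ i)) else 0)" for i
      by (simp add: f_def coeff_sum if_distrib)
    have "f \<in> polys_over \<rat>"
      by (simp add: polys_over_def cf)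
    moreover have "f \<noteq> 0"
    proof
      assume "f = 0"
      obtain i where "i \<le> n" "u (y ^ i) \<noteq> 0" using u by auto
      then show False using cf[of i] \<open>f = 0\<close> by simp
    qed
    moreover have "poly f y = 0"
      using u(1) True by (simp add: f_def poly_sum poly_monom sum.reindex)
    ultimately show ?thesis by blast
  qed
qed

text \<open>The minimal polynomial of \<theta> over the field \<open>F\<close> has degree at least
  two because \<theta> is not in \<open>F\<close>, and \<theta> is a simple root of it. So it has a
  second complex root, and substituting that root for \<theta> is well defined.\<close>

lemma nontrivial_embedding_of_adjoin:
  assumes F: "rat_subalgebra F" and inv: "\<And>x. x \<in> F \<Longrightarrow> inverse x \<in> F" and "\<theta> \<notin> F"
    and ex: "f \<in> polys_over F" "f \<noteq> 0" "poly f \<theta> = 0"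
  shows "\<exists>\<sigma>::real \<Rightarrow> complex. field_embedding (adjoin F \<theta>) \<sigma> \<and> \<sigma> \<theta> \<noteq> of_real \<theta>"
proof -
  note cl = polys_over_closed[OF F]
  \<comment> \<open>\<open>m\<close> is a minimal polynomial of \<open>\<theta>\<close> over \<open>F\<close>, up to scaling; \<open>\<sigma>\<close> sends \<open>\<theta>\<close> to another root.\<close>
  let ?P = "\<lambda>m. m \<in> polys_over F \<and> m \<noteq> 0 \<and> poly m \<theta> = 0"
  obtain m where m: "?P m" and min: "\<And>g. ?P g \<Longrightarrow> degree m \<le> degree g"
    using ex_has_least_nat[of ?P f degree] ex by auto
  have dm: "degree m > 0"
    using m by (auto elim!: degree_eq_zeroE intro!: gr0I)
  obtain g where g: "m = [:- \<theta>, 1:] * g"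
    using m by (meson dvdE poly_eq_0_iff_dvd)
  have "g \<noteq> 0" using g m by auto
  \<comment> \<open>In characteristic zero the derivative is nonzero and of smaller degree, so by
    minimality it does not vanish at \<theta>: the root is simple.\<close>
  have "pderiv m \<noteq> 0" "degree (pderiv m) < degree m"
    using dm by (auto simp: pderiv_eq_0_iff degree_pderiv)
  then have "poly (pderiv m) \<theta> \<noteq> 0"
    using min[of "pderiv m"] cl(7) m by fastforce
  then have g\<theta>: "poly g \<theta> \<noteq> 0"
    unfolding g pderiv_mult by (simp add: pderiv_pCons del: mult_pCons_left)
  have "degree m \<noteq> 1"
  proof
    assume "degree m = 1"
    then obtain c d where cd: "m = [:c, d:]" "d \<noteq> 0"
      using degree1_coeffs by metis
    then have "\<theta> = - c * inverse d"
      using m by (simp add: field_simps add_eq_0_iff)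
    moreover have "coeff m 0 \<in> F" "coeff m 1 \<in> F"
      using m by (auto simp: polys_over_def)
    ultimately show False
      using cd \<open>\<theta> \<notin> F\<close> F inv by (simp add: rat_subalgebraD)
  qed
  then have "degree g > 0"
    using dm \<open>g \<noteq> 0\<close> by (simp add: g degree_mult_eq del: mult_pCons_left)
  let ?c = "map_poly complex_of_real"
  have ofr: "poly (?c h) (of_real x) = of_real (poly h x)" for h x
    by (induction h) (auto simp: map_poly_pCons)
  have "degree (?c g) > 0"
    using \<open>degree g > 0\<close> by (subst degree_map_poly) auto
  then obtain \<theta>' where \<theta>': "poly (?c g) \<theta>' = 0"
    using fundamental_theorem_of_algebra[of "?c g"] by (auto simp: constant_degree)
  have ne: "\<theta>' \<noteq> of_real \<theta>"
    using \<theta>' g\<theta> ofr[of g \<theta>] by auto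
  have hom: "poly (?c (p + q)) \<theta>' = poly (?c p) \<theta>' + poly (?c q) \<theta>'"
    "poly (?c (p - q)) \<theta>' = poly (?c p) \<theta>' - poly (?c q) \<theta>'"
    "poly (?c (p * q)) \<theta>' = poly (?c p) \<theta>' * poly (?c q) \<theta>'"
    "poly (?c (smult a q)) \<theta>' = of_real a * poly (?c q) \<theta>'" for p q a
  proof -
    have 1: "?c (p + q) = ?c p + ?c q" for p q
      by (simp add: poly_eq_iff coeff_map_poly)
    have 2: "?c (p - q) = ?c p - ?c q" for p q
      by (simp add: poly_eq_iff coeff_map_poly)
    have 3: "?c (p * q) = ?c p * ?c q" for p q
      by (simp add: poly_eq_iff coeff_map_poly coeff_mult)
    have 4: "?c (smult a q) = smult (of_real a) (?c q)"
      by (simp add: poly_eq_iff coeff_map_poly)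
    show "poly (?c (p + q)) \<theta>' = poly (?c p) \<theta>' + poly (?c q) \<theta>'"
      "poly (?c (p - q)) \<theta>' = poly (?c p) \<theta>' - poly (?c q) \<theta>'"
      "poly (?c (p * q)) \<theta>' = poly (?c p) \<theta>' * poly (?c q) \<theta>'"
      "poly (?c (smult a q)) \<theta>' = of_real a * poly (?c q) \<theta>'"
      by (simp_all add: 1 2 3 4)
  qed
  have m\<theta>': "poly (?c m) \<theta>' = 0"
    unfolding g hom(3) using \<theta>' by simp
  \<comment> \<open>Every relation of \<theta> over \<open>F\<close> also holds for the other root.
    The induction is division by \<open>m\<close> with remainder, one leading term at a
    time.\<close>
  have key: "poly (?c f) \<theta>' = 0" if "f \<in> polys_over F" "poly f \<theta> = 0" for f
    using that
  proof (induction "degree f" arbitrary: f rule: less_induct)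
    case less
    show ?case
    proof (cases "f = 0")
      case False
      then have le: "degree m \<le> degree f" using min less.prems by blast
      \<comment> \<open>The leading terms cancel. Scaling \<open>f\<close> by the leading
        coefficient of \<open>m\<close> avoids dividing by it.\<close>
      define r where "r = smult (lead_coeff m) f - monom (lead_coeff f) (degree f - degree m) * m"
      have "lead_coeff m \<in> F" "lead_coeff f \<in> F"
        using less.prems m by (auto simp: polys_over_def)
      then have r: "r \<in> polys_over F"
        unfolding r_def using less.prems m by (intro cl) auto
      have r0: "poly r \<theta> = 0"
        using less.prems m by (simp add: r_def)
      have "degree r \<le> degree f"
        unfolding r_def using le
        using degree_mult_le[of "monom (lead_coeff f) (degree f - degree m)" m]
        degree_monom_le[of "lead_coeff f" "degree f - degree m"]
      by (intro degree_diff_le) auto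
      moreover have "coeff r (degree f) = 0"
        using le by (simp add: r_def coeff_monom_mult)
      moreover have "degree f \<noteq> 0"
        using dm le by simp
      ultimately have "degree r < degree f"
        using eq_zero_or_degree_less[of r "degree f"] by auto
      then have "poly (?c r) \<theta>' = 0"
        using less.hyps r r0 by blast
      then have "of_real (lead_coeff m) * poly (?c f) \<theta>' = 0"
        unfolding r_def hom using m\<theta>' by simp
      then show ?thesis using m by simp
    qed simp
  qed
  \<comment> \<open>An arbitrary polynomial expression in \<theta> is chosen for each element;
    \<open>key\<close> makes the value of \<sigma> independent of the choice.\<close>
  define rep where "rep x = (SOME f. f \<in> polys_over F \<and> poly f \<theta> = x)" for x
  define \<sigma> where "\<sigma> x = poly (?c (rep x)) \<theta>'" for x
  have \<sigma>: "\<sigma> (poly f \<theta>) = poly (?c f) \<theta>'" if "f \<in> polys_over F" for f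
  proof -
    have "rep (poly f \<theta>) \<in> polys_over F \<and> poly (rep (poly f \<theta>)) \<theta> = poly f \<theta>"
      unfolding rep_def by (rule someI) (use that in auto)
    then have "poly (?c (rep (poly f \<theta>) - f)) \<theta>' = 0"
      using that by (intro key cl) auto
    then show ?thesis by (simp add: \<sigma>_def hom)
  qed
  have "field_embedding (adjoin F \<theta>) \<sigma>"
    unfolding field_embedding_def
  proof (intro conjI ballI)
    have "[:1:] \<in> polys_over F" by (intro cl rat_subalgebraD[OF F])
    from \<sigma>[OF this] show "\<sigma> 1 = 1" by (simp add: map_poly_pCons)
    fix x y assume "x \<in> adjoin F \<theta>" "y \<in> adjoin F \<theta>"
    then obtain f g where fg: "x = poly f \<theta>" "y = poly g \<theta>" "f \<in> polys_over F" "g \<in> polys_over F"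
      by (auto simp: adjoin_def)
    show "\<sigma> (x + y) = \<sigma> x + \<sigma> y" "\<sigma> (x * y) = \<sigma> x * \<sigma> y"
      using \<sigma>[of "f + g"] \<sigma>[of "f * g"] \<sigma>[of f] \<sigma>[of g] fg by (auto simp: cl hom)
  qed
  moreover have "\<sigma> \<theta> = \<theta>'"
  proof -
    have "[:0, 1:] \<in> polys_over F" by (intro cl rat_subalgebraD[OF F])
    from \<sigma>[OF this] show ?thesis by (simp add: map_poly_pCons)
  qed
  ultimately show ?thesis using ne by blast
qed

text \<open>Supplies a further place as soon as \<open>k\<close> is larger than \<rat>; ramification
  there is what a parabolic element contradicts.\<close>

lemma real_number_field_nontrivial_embedding:
  assumes k: "real_number_field k" and nQ: "\<not> k \<subseteq> \<rat>"
  shows "\<exists>\<sigma>::real \<Rightarrow> complex. field_embedding k \<sigma> \<and> (\<exists>x\<in>k. \<sigma> x \<noteq> of_real x)"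
proof -
  from k obtain B where B: "finite B" and kB: "k = lin_comb \<rat> B"
    and k1: "1 \<in> k" and kd: "\<And>x y. x \<in> k \<Longrightarrow> y \<in> k \<Longrightarrow> x - y \<in> k"
    and km: "\<And>x y. x \<in> k \<Longrightarrow> y \<in> k \<Longrightarrow> x * y \<in> k"
    by (auto simp: real_number_field_def)
  have k0: "0 \<in> k" using kd[OF k1 k1] by simp
  have ka: "x + y \<in> k" if "x \<in> k" "y \<in> k" for x y
    using kd[OF that(1) kd[OF k0 that(2)]] by simp
  have "\<rat> \<subseteq> k"
  proof
    fix x :: real assume x: "x \<in> \<rat>"
    from k1 obtain c where c: "1 = (\<Sum>v\<in>B. c v *\<^sub>R v)" "\<forall>v\<in>B. c v \<in> \<rat>"
      unfolding kB lin_comb_def by auto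
    have "x = (\<Sum>v\<in>B. (x * c v) *\<^sub>R v)"
      using arg_cong[OF c(1), of "\<lambda>s. x * s"] by (simp add: sum_distrib_left mult.assoc)
    moreover have "\<forall>v\<in>B. x * c v \<in> \<rat>" using c x by simp
    ultimately show "x \<in> k" unfolding kB lin_comb_def by (auto intro!: exI[of _ "\<lambda>v. x * c v"])
  qed
  then have kA: "rat_subalgebra k"
    using ka km by (simp add: rat_subalgebra_def)
  have Bk: "B \<subseteq> k"
  proof
    fix b assume "b \<in> B"
    then have "b = (\<Sum>v\<in>B. (if v = b then 1 else 0) *\<^sub>R v)"
      using B by (simp add: if_distrib[of "\<lambda>t. t * _"] cong: if_cong)
    then show "b \<in> k"
      unfolding kB lin_comb_def by (auto intro!: exI[of _ "\<lambda>v. if v = b then 1 else 0"])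
  qed
  have algk: "\<exists>f. f \<in> polys_over \<rat> \<and> f \<noteq> 0 \<and> poly f y = 0" if "y \<in> k" for y
  proof -
    have "y ^ i \<in> k" for i by (induction i) (auto simp: k1 km that)
    then show ?thesis using powers_algebraic B kB by blast
  qed
  \<comment> \<open>For a maximal \<open>S \<subseteq> B\<close> with \<open>\<rat>[S] \<noteq> k\<close>, one more generator yields \<open>k\<close>, so that no extension
    of embeddings along a tower of fields is needed.\<close>
  let ?H = "\<lambda>S. rat_subalgebra hull S"
  have HA: "rat_subalgebra (?H S)" for S
    by (rule hull_in) (auto simp: rat_subalgebra_def)
  have Hk: "?H S \<subseteq> k" if "S \<subseteq> B" for S
    using that Bk kA by (intro hull_minimal) auto
  let ?P = "\<lambda>S. S \<subseteq> B \<and> ?H S \<noteq> k"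
  \<comment> \<open>The empty set generates only \<rat>, so it is a starting point for the choice of
    a maximal \<open>S\<close>.\<close>
  have "?H {} \<subseteq> \<rat>"
    by (rule hull_minimal) (auto simp: rat_subalgebra_def)
  then have "?P {}" using nQ by auto
  moreover have "\<forall>S. ?P S \<longrightarrow> card S \<le> card B"
    using B by (auto simp: card_mono)
  ultimately obtain S where S: "?P S" and max: "\<And>T. ?P T \<Longrightarrow> card T \<le> card S"
    using ex_has_greatest_nat[of ?P "{}" card "Suc (card B)"] by (auto simp: less_Suc_eq_le)
  define F where "F = ?H S"
  have F: "rat_subalgebra F" and Fk: "F \<subseteq> k"
    using HA Hk S by (auto simp: F_def)
  have "\<not> B \<subseteq> F"
  proof
    assume BF: "B \<subseteq> F"
    have "k \<subseteq> F"
    proof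
      fix x assume "x \<in> k"
      then obtain c where c: "x = (\<Sum>v\<in>B. c v *\<^sub>R v)" "\<forall>v\<in>B. c v \<in> \<rat>"
        by (auto simp: kB lin_comb_def)
      then show "x \<in> F"
        using BF by (auto intro!: rat_subalgebra_sum[OF F] rat_subalgebraD(2-7)[OF F] intro: rat_subalgebraD(1)[OF F])
    qed
    then show False using S Fk by (simp add: F_def)
  qed
  then obtain \<theta> where \<theta>: "\<theta> \<in> B" "\<theta> \<notin> F" by auto
  have SF: "S \<subseteq> F" unfolding F_def by (rule hull_subset)
  have "?H (insert \<theta> S) = k"
  proof (rule ccontr)
    assume "?H (insert \<theta> S) \<noteq> k"
    then have "card (insert \<theta> S) \<le> card S" using max S \<theta> by blast
    then show False using \<theta> SF S B finite_subset[of S B] by (auto simp: card_insert_if split: if_splits)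
  qed
  moreover have "?H (insert \<theta> S) \<subseteq> adjoin F \<theta>"
    using rat_subalgebra_adjoin[OF F, of \<theta>] SF by (intro hull_minimal) auto
  moreover have "adjoin F \<theta> \<subseteq> k"
  proof
    fix x assume "x \<in> adjoin F \<theta>"
    then obtain f where "f \<in> polys_over F" "x = poly f \<theta>" by (auto simp: adjoin_def)
    then show "x \<in> k"
      using Fk \<theta> Bk by (auto simp: polys_over_def subset_iff intro!: poly_in_subalgebra[OF kA])
  qed
  ultimately have kF: "k = adjoin F \<theta>" by blast
  \<comment> \<open>\<open>F\<close> is by construction only a ring; it is a field because its
    elements are algebraic over \<rat>.\<close>
  have inv: "inverse x \<in> F" if xF: "x \<in> F" for x
  proof (cases "x = 0")
    case True
    then show ?thesis using xF by simp
  next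
    case False
    obtain f where "f \<in> polys_over \<rat>" "f \<noteq> 0" "poly f x = 0"
      using algk \<open>x \<in> F\<close> Fk by (meson subsetD)
    then show ?thesis using inverse_in_subalgebra[OF F xF False] by blast
  qed
  obtain f where f: "f \<in> polys_over \<rat>" "f \<noteq> 0" "poly f \<theta> = 0"
    using algk \<theta> Bk by blast
  moreover have "polys_over \<rat> \<subseteq> polys_over F"
    using F by (auto simp: polys_over_def rat_subalgebra_def)
  ultimately show ?thesis
    using nontrivial_embedding_of_adjoin[OF F inv \<theta>(2)] \<theta> Bk unfolding kF[symmetric] by blast
qed

section \<open>Matrices of determinant one\<close>

lemmas mat2_simps = vec_eq_iff forall_2 sum_2 matrix_matrix_mult_def trace_def det_2 mat_def

text \<open>The adjugate, which is the inverse when the determinant is one. Its entries are linear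
  in those of \<open>M\<close>, so identities involving inverses become polynomial
  identities.\<close>

definition adj2 :: "real^2^2 \<Rightarrow> real^2^2" where
  "adj2 M = trace M *\<^sub>R mat 1 - M"

lemma cayley_hamilton2: "M ** M = trace M *\<^sub>R M - det M *\<^sub>R mat 1"
  for M :: "real^2^2"
  by (simp add: mat2_simps algebra_simps)

lemma adj2_mult: "M ** adj2 M = det M *\<^sub>R mat 1" "adj2 M ** M = det M *\<^sub>R mat 1"
  by (simp_all add: adj2_def mat2_simps algebra_simps)

lemma det_adj2: "det (adj2 M) = det M"
  by (simp add: adj2_def mat2_simps algebra_simps)

lemma det_uminus2: "det (- M) = det (M :: real^2^2)"
  by (simp add: mat2_simps)

lemma SL2R_simps [simp]:
  "M \<in> carrier SL2R \<longleftrightarrow> det M = 1" "M \<otimes>\<^bsub>SL2R\<^esub> N = M ** N" "\<one>\<^bsub>SL2R\<^esub> = mat 1"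
  by (simp_all add: SL2R_def)

lemma group_SL2R: "group SL2R"
proof (rule groupI)
  fix M assume "M \<in> carrier SL2R"
  then have "adj2 M \<in> carrier SL2R" "adj2 M \<otimes>\<^bsub>SL2R\<^esub> M = \<one>\<^bsub>SL2R\<^esub>"
    by (simp_all add: det_adj2 adj2_mult)
  then show "\<exists>N\<in>carrier SL2R. N \<otimes>\<^bsub>SL2R\<^esub> M = \<one>\<^bsub>SL2R\<^esub>" by blast
qed (simp_all add: det_mul matrix_mul_assoc)

interpretation SL2R: group SL2R by (rule group_SL2R)

lemma inv_SL2R: "det M = 1 \<Longrightarrow> inv\<^bsub>SL2R\<^esub> M = adj2 M"
  by (rule SL2R.inv_equality) (simp_all add: det_adj2 adj2_mult)

lemma minus_one_mult: "- mat 1 ** M = - M" "M ** - mat 1 = - (M :: real^2^2)"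
  "(- M) ** N = - (M ** N :: real^2^2)" "M ** (- N) = - (M ** N :: real^2^2)"
  for M N :: "real^2^2"
  by (simp_all add: mat2_simps)

lemma to_PSL2R_eq: "to_PSL2R M = {M, - M}"
  by (auto simp: to_PSL2R_def r_coset_def minus_one_mult)

lemma to_PSL2R_eq_iff: "to_PSL2R M = to_PSL2R N \<longleftrightarrow> M = N \<or> M = - N"
  by (auto simp: to_PSL2R_eq doubleton_eq_iff)

lemma normal_center: "{mat 1, - mat 1} \<lhd> SL2R"
proof (rule SL2R.normal_invI)
  show "subgroup {mat 1, - mat 1} SL2R"
    by (rule SL2R.subgroupI)
      (auto simp: minus_one_mult det_uminus2 inv_SL2R adj2_def mat2_simps)
  fix M C :: "real^2^2" assume "M \<in> carrier SL2R" "C \<in> {mat 1, - mat 1}"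
  then show "M \<otimes>\<^bsub>SL2R\<^esub> C \<otimes>\<^bsub>SL2R\<^esub> inv\<^bsub>SL2R\<^esub> M \<in> {mat 1, - mat 1}"
    by (auto simp: inv_SL2R minus_one_mult adj2_mult)
qed

lemma group_PSL2R: "group PSL2R"
  unfolding PSL2R_def by (rule normal.factorgroup_is_group[OF normal_center])

interpretation PSL2R: group PSL2R by (rule group_PSL2R)

lemma to_PSL2R_hom: "to_PSL2R \<in> hom SL2R PSL2R"
  using normal.r_coset_hom_Mod[OF normal_center]
  unfolding PSL2R_def to_PSL2R_def[abs_def] .

lemma PSL2R_cases:
  assumes "X \<in> carrier PSL2R"
  obtains M where "det M = 1" "X = to_PSL2R M"
  using assms by (auto simp: PSL2R_def FactGroup_def RCOSETS_def to_PSL2R_def)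

interpretation to_PSL2R: group_hom SL2R PSL2R to_PSL2R
  by (simp add: group_hom_def group_hom_axioms_def group_SL2R group_PSL2R to_PSL2R_hom)

lemma to_PSL2R_one: "\<one>\<^bsub>PSL2R\<^esub> = to_PSL2R (mat 1)"
  using to_PSL2R.hom_one by simp

lemma to_PSL2R_mult: "det M = 1 \<Longrightarrow> det N = 1 \<Longrightarrow> to_PSL2R (M ** N) = to_PSL2R M \<otimes>\<^bsub>PSL2R\<^esub> to_PSL2R N"
  using to_PSL2R.hom_mult[of M N] by simp

lemma to_PSL2R_inv: "det M = 1 \<Longrightarrow> to_PSL2R (adj2 M) = inv\<^bsub>PSL2R\<^esub> to_PSL2R M"
  using to_PSL2R.hom_inv[of M] by (simp add: inv_SL2R)

lemma to_PSL2R_pow: "det M = 1 \<Longrightarrow> to_PSL2R (M [^]\<^bsub>SL2R\<^esub> (n::nat)) = to_PSL2R M [^]\<^bsub>PSL2R\<^esub> n"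
  using to_PSL2R.hom_nat_pow[of M n] by simp

section \<open>Powers of matrices and of elements of finite-index subgroups\<close>

lemma unipotent_pow:
  fixes N :: "real^2^2"
  assumes "N ** N = 0"
  shows "(mat 1 + N) [^]\<^bsub>SL2R\<^esub> n = mat 1 + real n *\<^sub>R N"
proof (induction n)
  case (Suc n)
  have "(mat 1 + N) [^]\<^bsub>SL2R\<^esub> Suc n = (mat 1 + real n *\<^sub>R N) ** (mat 1 + N)"
    using Suc by simp
  also have "\<dots> = mat 1 + real (Suc n) *\<^sub>R N + real n *\<^sub>R (N ** N)"
    by (simp add: mat2_simps algebra_simps)
  finally show ?case using assms by simp
qed simp

text \<open>By Cayley-Hamilton each power of \<open>M\<close> is a combination of \<open>M\<close>
  and the identity. For a hyperbolic \<open>M\<close> the coefficient of \<open>M\<close> does not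
  vanish, so the relation can be solved for \<open>M\<close>.\<close>

lemma pow_in_pencil:
  fixes M :: "real^2^2"
  assumes "det M = 1" and tr: "\<bar>trace M\<bar> > 2" and "n > 0"
  shows "\<exists>r r'. M = r *\<^sub>R (M [^]\<^bsub>SL2R\<^esub> (n::nat)) + r' *\<^sub>R mat 1"
proof -
  \<comment> \<open>\<open>f n\<close> consists of two consecutive terms of the Chebyshev-type sequence of coefficients.\<close>
  define f where "f = rec_nat (0, 1) (\<lambda>_ (a, b). (b, trace M * b - a))"
  have f: "f 0 = (0, 1)" "f (Suc n) = (snd (f n), trace M * snd (f n) - fst (f n))" for n
    by (simp_all add: f_def split_beta)
  have pw: "M [^]\<^bsub>SL2R\<^esub> Suc n = snd (f n) *\<^sub>R M - fst (f n) *\<^sub>R mat 1" for n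
  proof (induction n)
    case 0
    then show ?case by (simp add: f)
  next
    case (Suc n)
    have CH: "M ** M = trace M *\<^sub>R M - mat 1"
      using assms(1) cayley_hamilton2[of M] by simp
    have "M [^]\<^bsub>SL2R\<^esub> Suc (Suc n) = (snd (f n) *\<^sub>R M - fst (f n) *\<^sub>R mat 1) ** M"
      using Suc by simp
    also have "\<dots> = snd (f n) *\<^sub>R (M ** M) - fst (f n) *\<^sub>R M"
      by (simp add: mat2_simps algebra_simps)
    also have "\<dots> = snd (f (Suc n)) *\<^sub>R M - fst (f (Suc n)) *\<^sub>R mat 1"
      unfolding CH f by (simp add: algebra_simps)
    finally show ?case .
  qed
  \<comment> \<open>Since \<open>trace M\<close> exceeds 2 in absolute value, the terms of the
    recurrence grow strictly in absolute value and stay nonzero.\<close>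
  have inc: "\<bar>fst (f n)\<bar> < \<bar>snd (f n)\<bar>" for n
  proof (induction n)
    case (Suc n)
    have "\<bar>trace M * snd (f n)\<bar> \<ge> 2 * \<bar>snd (f n)\<bar>"
      using tr by (simp add: abs_mult mult_right_mono)
    then show ?case using Suc unfolding f by simp
  qed (simp add: f)
  obtain k where n: "n = Suc k" using \<open>n > 0\<close> gr0_implies_Suc by blast
  have nz: "snd (f k) \<noteq> 0" using inc[of k] by auto
  then have "M = (1 / snd (f k)) *\<^sub>R M [^]\<^bsub>SL2R\<^esub> n + (fst (f k) / snd (f k)) *\<^sub>R mat 1"
    unfolding n pw by (simp add: algebra_simps)
  then show ?thesis by blast
qed

text \<open>Pigeonhole: two powers of \<open>g\<close> have the same coset, and the quotient of
  these powers lies in \<open>K\<close>.\<close>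

lemma (in group) finite_index_power:
  assumes H: "subgroup H G" and "\<one> \<in> K" and fin: "finite_index G (H \<inter> K) H" and g: "g \<in> H"
  shows "\<exists>n>0. g [^] (n::nat) \<in> K"
proof -
  let ?c = "\<lambda>n::nat. (H \<inter> K) #> (g [^] n)"
  have gG: "g \<in> carrier G" and HG: "H \<subseteq> carrier G"
    using H g by (auto dest: subgroup.subset)
  have gH: "g [^] (n::nat) \<in> H" for n
    by (induction n) (use H g in \<open>auto simp: subgroup.one_closed subgroup.m_closed\<close>)
  have "?c n \<in> rcosets\<^bsub>G\<lparr>carrier := H\<rparr>\<^esub> (H \<inter> K)" for n
    using gH[of n] by (auto simp: RCOSETS_def r_coset_def)
  then have "range ?c \<subseteq> rcosets\<^bsub>G\<lparr>carrier := H\<rparr>\<^esub> (H \<inter> K)"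
    by (rule image_subsetI)
  then have "finite (range ?c)"
    using fin unfolding finite_index_def by (rule finite_subset)
  then have "\<not> inj ?c"
    using finite_imageD[of ?c UNIV] by auto
  then obtain i' j' where "?c i' = ?c j'" "i' \<noteq> j'"
    unfolding inj_def by blast
  then obtain i j :: nat where ij: "i < j" "?c i = ?c j"
    using that[of i' j'] that[of j' i'] by (metis linorder_neqE_nat)
  have "g [^] j \<in> ?c j"
    using \<open>\<one> \<in> K\<close> H gG by (auto simp: r_coset_def subgroup.one_closed intro!: bexI[of _ \<one>])
  then obtain m where m: "m \<in> H \<inter> K" "g [^] j = m \<otimes> g [^] i"
    unfolding ij(2)[symmetric] by (auto simp: r_coset_def)
  have "g [^] (j - i) \<otimes> g [^] i = m \<otimes> g [^] i"
    using ij(1) m(2) gG by (simp add: nat_pow_mult)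
  then have "g [^] (j - i) = m"
    using m(1) gG HG by (auto simp: right_cancel)
  then show ?thesis using m ij(1) by (intro exI[of _ "j - i"]) auto
qed

text \<open>The model is a conjugate of the image of a rational quaternion algebra under a real
  splitting, where matrix traces are reduced traces.\<close>

definition rational_matrix_algebra :: "(real^2^2) set \<Rightarrow> bool" where
  "rational_matrix_algebra \<A> \<longleftrightarrow>
     mat 1 \<in> \<A> \<and> (\<forall>M\<in>\<A>. \<forall>N\<in>\<A>. M - N \<in> \<A> \<and> M ** N \<in> \<A>) \<and>
     (\<forall>q\<in>\<rat>. \<forall>M\<in>\<A>. q *\<^sub>R M \<in> \<A>) \<and> (\<forall>M\<in>\<A>. trace M \<in> \<rat>)"

text \<open>This replaces the Skolem-Noether theorem in showing that the traces of \<open>A\<^sup>2\<close> and \<open>B\<^sup>2\<close> lie in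
  the invariant trace field: the trace-free part of \<open>A ** B\<close> is a combination of those of \<open>U\<close>, \<open>V\<close> and
  of their commutator \<open>c\<close>, and pairing it with \<open>c\<close>, \<open>[v, c]\<close> and \<open>[c, u]\<close> under the trace form isolates
  the three coefficients.\<close>

lemma rational_traces_of_lines:
  fixes A B U V W :: "real^2^2"
  assumes alg: "rational_matrix_algebra \<A>" and mem: "U \<in> \<A>" "V \<in> \<A>" "W \<in> \<A>"
    and dets: "det A = 1" "det B = 1" and irr: "det (A ** B - B ** A) \<noteq> 0"
    and A: "A = r *\<^sub>R U + r' *\<^sub>R mat 1" and B: "B = s *\<^sub>R V + s' *\<^sub>R mat 1"
    and AB: "A ** B = t *\<^sub>R W + t' *\<^sub>R mat 1"
  shows "(trace A)\<^sup>2 \<in> \<rat>" "trace A * trace B * trace (A ** B) \<in> \<rat>"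
proof -
  have cl: "M - N \<in> \<A>" "M ** N \<in> \<A>" "q \<in> \<rat> \<Longrightarrow> q *\<^sub>R M \<in> \<A>" "trace M \<in> \<rat>" "mat 1 \<in> \<A>"
    if "M \<in> \<A>" "N \<in> \<A>" for M N q
    using alg that by (auto simp: rational_matrix_algebra_def)
  define u where "u = U - (trace U / 2) *\<^sub>R mat 1"
  define v where "v = V - (trace V / 2) *\<^sub>R mat 1"
  define w where "w = W - (trace W / 2) *\<^sub>R mat 1"
  have uvw: "u \<in> \<A>" "v \<in> \<A>" "w \<in> \<A>"
    unfolding u_def v_def w_def using mem by (auto intro!: cl Rats_divide)
  have u: "u$2$2 = - u$1$1" and v: "v$2$2 = - v$1$1" and w: "w$2$2 = - w$1$1"
    by (simp_all add: u_def v_def w_def mat2_simps field_simps)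
  define x where "x = trace A / 2"
  define y where "y = trace B / 2"
  have A': "A = r *\<^sub>R u + x *\<^sub>R mat 1" and B': "B = s *\<^sub>R v + y *\<^sub>R mat 1"
    unfolding x_def y_def A B u_def v_def by (simp_all add: mat2_simps field_simps)
  have AB': "A ** B = t *\<^sub>R w + (trace (A ** B) / 2) *\<^sub>R mat 1"
    unfolding AB w_def by (simp add: mat2_simps field_simps)
  define c where "c = u ** v - v ** u"
  have c: "c \<in> \<A>" unfolding c_def using uvw by (intro cl)
  define \<kappa> where "\<kappa> = trace (c ** c)"
  define q1 where "q1 = trace (w ** c)"
  define q2 where "q2 = trace (w ** (v ** c - c ** v))"
  define q3 where "q3 = trace (w ** (c ** u - u ** c))"
  define p where "p = trace (u ** u)"
  define o' where "o' = trace (u ** v)"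
  have rat: "\<kappa> \<in> \<rat>" "q1 \<in> \<rat>" "q2 \<in> \<rat>" "q3 \<in> \<rat>" "p \<in> \<rat>" "o' \<in> \<rat>"
    unfolding \<kappa>_def q1_def q2_def q3_def p_def o'_def using uvw c by (auto intro!: cl)
  have comm: "A ** B - B ** A = (r * s) *\<^sub>R c"
    unfolding A' B' c_def by (simp add: mat2_simps algebra_simps)
  \<comment> \<open>Hence the irreducibility hypothesis makes \<open>r\<close>, \<open>s\<close> and
    \<kappa> nonzero together.\<close>
  have "2 * det (A ** B - B ** A) = - ((r * s)\<^sup>2 * \<kappa>)"
    unfolding comm \<kappa>_def c_def by (simp add: mat2_simps u v power2_eq_square algebra_simps)
  then have nz: "r * s * \<kappa> \<noteq> 0" using irr by auto
  \<comment> \<open>Trace-free part of the product \<open>(r u + x) (s v + y)\<close>; the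
    trace-free part of \<open>u ** v\<close> is \<open>c / 2\<close>.\<close>
  have tw: "t *\<^sub>R w = (r * y) *\<^sub>R u + (s * x) *\<^sub>R v + (r * s / 2) *\<^sub>R c"
  proof -
    have "t *\<^sub>R w = A ** B - (trace (A ** B) / 2) *\<^sub>R mat 1"
      unfolding eq_diff_eq by (rule AB'[symmetric])
    also have "\<dots> = (r * y) *\<^sub>R u + (s * x) *\<^sub>R v + (r * s / 2) *\<^sub>R c"
      unfolding A' B' c_def by (simp add: mat2_simps u v field_simps)
    finally show ?thesis .
  qed
  have lin: "t * trace (w ** Z) = r * y * trace (u ** Z) + s * x * trace (v ** Z) + r * s / 2 * trace (c ** Z)" for Z
  proof -
    have "t * trace (w ** Z) = trace ((t *\<^sub>R w) ** Z)"
      by (simp add: mat2_simps algebra_simps)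
    then show ?thesis unfolding tw by (simp add: mat2_simps algebra_simps)
  qed
  have e1: "t * q1 = r * s / 2 * \<kappa>"
  proof -
    have "trace (u ** c) = 0" "trace (v ** c) = 0"
      by (simp_all add: c_def mat2_simps u v algebra_simps)
    then show ?thesis unfolding q1_def lin \<kappa>_def by simp
  qed
  have e2: "t * q2 = r * y * \<kappa>"
  proof -
    have "trace (v ** (v ** c - c ** v)) = 0" "trace (c ** (v ** c - c ** v)) = 0"
      by (simp_all add: mat2_simps v algebra_simps)
    moreover have "trace (u ** (v ** c - c ** v)) = \<kappa>"
      by (simp add: \<kappa>_def c_def mat2_simps u v algebra_simps)
    ultimately show ?thesis unfolding q2_def lin by simp
  qed
  have e3: "t * q3 = s * x * \<kappa>"
  proof -
    have "trace (u ** (c ** u - u ** c)) = 0" "trace (c ** (c ** u - u ** c)) = 0"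
      by (simp_all add: mat2_simps u algebra_simps)
    moreover have "trace (v ** (c ** u - u ** c)) = \<kappa>"
      by (simp add: \<kappa>_def c_def mat2_simps u v algebra_simps)
    ultimately show ?thesis unfolding q3_def lin by simp
  qed
  have "t * q1 \<noteq> 0" unfolding e1 using nz by simp
  then have q1: "q1 \<noteq> 0" "t \<noteq> 0" by auto
  \<comment> \<open>Dividing \<open>e3\<close> and \<open>e2\<close> by \<open>e1\<close> eliminates
    the unknown \<open>t\<close>: \<open>X\<close> and \<open>Y\<close> turn out to be
    \<open>x / r\<close> and \<open>y / s\<close>.\<close>
  define X where "X = q3 / (2 * q1)"
  define Y where "Y = q2 / (2 * q1)"
  have XY: "X \<in> \<rat>" "Y \<in> \<rat>" unfolding X_def Y_def using rat by (auto intro!: Rats_divide)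
  have t: "t = r * s / 2 * \<kappa> / q1" using e1 q1 by (simp add: field_simps)
  have xX: "x = r * X"
  proof -
    have "(s * \<kappa>) * x = (s * \<kappa>) * (r * X)" using e3 unfolding t X_def by (simp add: ac_simps)
    then show ?thesis using nz by simp
  qed
  have yY: "y = s * Y"
  proof -
    have "(r * \<kappa>) * y = (r * \<kappa>) * (s * Y)" using e2 unfolding t Y_def by (simp add: ac_simps)
    then show ?thesis using nz by simp
  qed
  have det1: "1 = x\<^sup>2 - r\<^sup>2 * p / 2"
    using dets(1) unfolding A' p_def by (simp add: mat2_simps u power2_eq_square algebra_simps)
  have det2: "1 = y\<^sup>2 - s\<^sup>2 * trace (v ** v) / 2"
    using dets(2) unfolding B' by (simp add: mat2_simps v power2_eq_square algebra_simps)
  \<comment> \<open>With \<open>x = r X\<close> the equation \<open>det A = 1\<close> exhibits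
    \<open>r\<close> squared as the inverse of a rational number, although \<open>r\<close> itself
    may be irrational.\<close>
  have r2: "r\<^sup>2 \<in> \<rat>"
  proof -
    have "r\<^sup>2 * (X\<^sup>2 - p / 2) = 1" using det1 xX by (simp add: power2_eq_square algebra_simps)
    then have "r\<^sup>2 = inverse (X\<^sup>2 - p / 2)" by (simp add: inverse_unique mult.commute)
    then show ?thesis using XY rat by simp
  qed
  have s2: "s\<^sup>2 \<in> \<rat>"
  proof -
    have "s\<^sup>2 * (Y\<^sup>2 - trace (v ** v) / 2) = 1" using det2 yY by (simp add: power2_eq_square algebra_simps)
    then have "s\<^sup>2 = inverse (Y\<^sup>2 - trace (v ** v) / 2)" by (simp add: inverse_unique mult.commute)
    moreover have "trace (v ** v) \<in> \<rat>" using uvw by (auto intro!: cl)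
    ultimately show ?thesis using XY by simp
  qed
  have tA: "trace A = 2 * r * X" "trace B = 2 * s * Y" using xX yY by (simp_all add: x_def y_def)
  show "(trace A)\<^sup>2 \<in> \<rat>"
    unfolding tA power_mult_distrib using r2 XY by simp
  have "trace (A ** B) = 2 * x * y + r * s * o'"
    unfolding A' B' o'_def by (simp add: mat2_simps u v algebra_simps)
  \<comment> \<open>Each of the three traces may carry an irrational factor \<open>r\<close>,
    \<open>s\<close> or \<open>r s\<close>; in the product these occur only squared.\<close>
  then have "trace A * trace B * trace (A ** B) = r\<^sup>2 * s\<^sup>2 * (4 * X * Y * (2 * X * Y + o'))"
    unfolding tA xX yY by (simp add: power2_eq_square algebra_simps)
  then show "trace A * trace B * trace (A ** B) \<in> \<rat>"
    using r2 s2 XY rat by simp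
qed

section \<open>Arithmetic groups with parabolic elements\<close>

lemma quat_mult_components:
  "quat_mult \<alpha> \<beta> x y $ 1 = x$1 * y$1 + \<alpha> * (x$2 * y$2) + \<beta> * (x$3 * y$3) - \<alpha> * \<beta> * (x$4 * y$4)"
  "quat_mult \<alpha> \<beta> x y $ 2 = x$1 * y$2 + x$2 * y$1 - \<beta> * (x$3 * y$4) + \<beta> * (x$4 * y$3)"
  "quat_mult \<alpha> \<beta> x y $ 3 = x$1 * y$3 + x$3 * y$1 + \<alpha> * (x$2 * y$4) - \<alpha> * (x$4 * y$2)"
  "quat_mult \<alpha> \<beta> x y $ 4 = x$1 * y$4 + x$4 * y$1 + x$2 * y$3 - x$3 * y$2"
  "quat_one $ 1 = 1" "quat_one $ 2 = 0" "quat_one $ 3 = 0" "quat_one $ 4 = 0"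
  by (simp_all add: quat_mult_def quat_one_def vector_def numeral_eq_Suc)

lemma pure_quat_square:
  assumes "x$1 = 0"
  shows "quat_mult \<alpha> \<beta> x x = (- quat_norm \<alpha> \<beta> x) *\<^sub>R quat_one"
  using assms
  by (simp add: vec_eq_iff forall_4 quat_mult_components quat_norm_def power2_eq_square algebra_simps)

text \<open>The image of a pure quaternion has scalar square. Were its trace nonzero,
  Cayley-Hamilton would make the image itself scalar, and injectivity would make \<open>x\<close> a
  scalar with zero scalar part.\<close>

lemma split_iso_pure:
  assumes \<phi>: "split_iso \<alpha> \<beta> \<phi>" and x: "x$1 = 0"
  shows "trace (\<phi> x) = 0" "det (\<phi> x) = quat_norm \<alpha> \<beta> x"
proof -
  have lin: "linear \<phi>" and inj: "inj \<phi>" and one: "\<phi> quat_one = mat 1"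
    and mult: "\<phi> (quat_mult \<alpha> \<beta> x y) = \<phi> x ** \<phi> y" for x y
    using \<phi> by (auto simp: split_iso_def bij_def)
  define M where "M = \<phi> x"
  have sq: "M ** M = (- quat_norm \<alpha> \<beta> x) *\<^sub>R mat 1"
    unfolding M_def mult[symmetric] pure_quat_square[OF x] using lin one by (simp add: linear_scale linear_neg)
  have tr: "trace M = 0"
  proof (rule ccontr)
    assume nz: "trace M \<noteq> 0"
    have "trace M * M$1$2 = 0" "trace M * M$2$1 = 0" "trace M * (M$1$1 - M$2$2) = 0"
      using sq by (simp_all add: mat2_simps algebra_simps)
    then have "M = M$1$1 *\<^sub>R mat 1"
      using nz by (simp add: vec_eq_iff forall_2 mat_def)
    then have "\<phi> x = \<phi> (M$1$1 *\<^sub>R quat_one)"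
      using lin one by (simp add: linear_scale M_def)
    then have "x = M$1$1 *\<^sub>R quat_one" using inj by (simp add: inj_def)
    then have "M$1$1 = 0" using x by (metis mult.right_neutral quat_mult_components(5) vector_scaleR_component real_scaleR_def)
    then show False using nz \<open>M = M$1$1 *\<^sub>R mat 1\<close> by (simp add: trace_def sum_2 mat_def vec_eq_iff forall_2)
  qed
  then show "trace (\<phi> x) = 0" by (simp add: M_def)
  have "M$1$1 * M$1$1 + M$1$2 * M$2$1 = - quat_norm \<alpha> \<beta> x" "M$2$2 = - M$1$1"
    using sq tr by (simp_all add: mat2_simps algebra_simps)
  then show "det (\<phi> x) = quat_norm \<alpha> \<beta> x"
    unfolding M_def[symmetric] by (simp add: det_2)
qed

lemma split_iso_trace_det:
  assumes \<phi>: "split_iso \<alpha> \<beta> \<phi>"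
  shows "trace (\<phi> x) = 2 * x$1" "det (\<phi> x) = quat_norm \<alpha> \<beta> x"
proof -
  define y where "y = x - x$1 *\<^sub>R quat_one"
  have y1: "y$1 = 0" by (simp add: y_def quat_mult_components)
  have lin: "linear \<phi>" and one: "\<phi> quat_one = mat 1"
    using \<phi> by (auto simp: split_iso_def)
  have "\<phi> x = \<phi> (x$1 *\<^sub>R quat_one + y)" by (simp add: y_def)
  also have "\<dots> = x$1 *\<^sub>R mat 1 + \<phi> y"
    using lin one by (simp add: linear_add linear_scale)
  finally have \<phi>x: "\<phi> x = x$1 *\<^sub>R mat 1 + \<phi> y" .
  note py = split_iso_pure[OF \<phi> y1]
  show "trace (\<phi> x) = 2 * x$1"
    unfolding \<phi>x using py(1) by (simp add: trace_def sum_2 mat_def)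
  have "det (\<phi> x) = (x$1)\<^sup>2 + x$1 * trace (\<phi> y) + det (\<phi> y)"
    unfolding \<phi>x by (simp add: mat2_simps power2_eq_square algebra_simps)
  also have "\<dots> = quat_norm \<alpha> \<beta> x"
    unfolding py by (simp add: quat_norm_def y_def quat_mult_components)
  finally show "det (\<phi> x) = quat_norm \<alpha> \<beta> x" .
qed

lemma lin_comb_mono: "R \<subseteq> S \<Longrightarrow> lin_comb R B \<subseteq> lin_comb S B"
  unfolding lin_comb_def by blast

text \<open>Such an \<open>x\<close> squares to zero, hence so does its image in Hamilton's
  quaternions, where only zero does.\<close>

lemma hamilton_no_nilpotents:
  assumes \<psi>: "hamilton_iso \<alpha> \<beta> \<psi>" and x: "x$1 = 0" "quat_norm \<alpha> \<beta> x = 0"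
  shows "x = 0"
proof -
  have lin: "linear \<psi>" and inj: "inj \<psi>"
    and mult: "\<psi> (quat_mult \<alpha> \<beta> x y) = quat_mult (-1) (-1) (\<psi> x) (\<psi> y)" for x y
    using \<psi> by (auto simp: hamilton_iso_def bij_def)
  define y where "y = \<psi> x"
  have "quat_mult (-1) (-1) y y = 0"
    unfolding y_def mult[symmetric] pure_quat_square[OF x(1)] x(2) using lin by (simp add: linear_0)
  then have "quat_mult (-1) (-1) y y $ i = 0" for i by simp
  from this[of 1] this[of 2] this[of 3] this[of 4]
  have c: "y$1 * y$1 = y$2 * y$2 + y$3 * y$3 + y$4 * y$4" "y$1 * y$2 = 0" "y$1 * y$3 = 0" "y$1 * y$4 = 0"
    by (simp_all add: quat_mult_components algebra_simps)
  have "y$1 = 0"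
  proof (rule ccontr)
    assume "y$1 \<noteq> 0"
    then have "y$2 = 0" "y$3 = 0" "y$4 = 0" using c by auto
    then show False using c \<open>y$1 \<noteq> 0\<close> by simp
  qed
  then have "y$2 * y$2 + y$3 * y$3 + y$4 * y$4 = 0" using c by simp
  then have "y$2 = 0" "y$3 = 0" "y$4 = 0"
    by (smt (verit) mult_eq_0_iff zero_le_square)+
  then have "y = 0" using \<open>y$1 = 0\<close> by (simp add: vec_eq_iff forall_4)
  then have "\<psi> x = \<psi> 0" using lin by (simp add: y_def linear_0)
  then show "x = 0" using inj by (simp add: inj_def)
qed

text \<open>Over a larger field there is a second real place. Applying it to the coordinates of
  \<open>x\<close> gives a nonzero pure quaternion of norm zero in a ramified completion.\<close>

lemma isotropic_imp_rational:
  assumes k: "real_number_field k" "totally_real k"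
    and ab: "\<alpha> \<in> k" "\<beta> \<in> k" and ram: "ramified_at_other_places k \<alpha> \<beta>"
    and x: "x \<in> quat_alg k" "x$1 = 0" "quat_norm \<alpha> \<beta> x = 0" "x \<noteq> 0"
  shows "k \<subseteq> \<rat>"
proof (rule ccontr)
  assume "\<not> k \<subseteq> \<rat>"
  then obtain \<tau> :: "real \<Rightarrow> complex" and z where \<tau>: "field_embedding k \<tau>" and z: "z \<in> k" "\<tau> z \<noteq> of_real z"
    using real_number_field_nontrivial_embedding[OF k(1)] by blast
  \<comment> \<open>The embedding is complex-valued; total realness lets its real part serve as a
    real place.\<close>
  define \<sigma> where "\<sigma> t = Re (\<tau> t)" for t
  have \<tau>\<sigma>: "\<tau> t = of_real (\<sigma> t)" if "t \<in> k" for t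
    using k(2) \<tau> that by (auto simp: totally_real_def \<sigma>_def complex_eq_iff complex_is_Real_iff image_subset_iff)
  have k1: "1 \<in> k" and kd: "\<And>s t. s \<in> k \<Longrightarrow> t \<in> k \<Longrightarrow> s - t \<in> k"
    and km: "\<And>s t. s \<in> k \<Longrightarrow> t \<in> k \<Longrightarrow> s * t \<in> k" and ki: "\<And>t. t \<in> k \<Longrightarrow> inverse t \<in> k"
    using k(1) by (auto simp: real_number_field_def)
  have k0: "0 \<in> k" using kd[OF k1 k1] by simp
  have ka: "s + t \<in> k" if "s \<in> k" "t \<in> k" for s t
    using kd[OF that(1) kd[OF k0 that(2)]] by simp
  have \<sigma>1: "\<sigma> 1 = 1" using \<tau> by (simp add: \<sigma>_def field_embedding_def)
  have \<sigma>a: "\<sigma> (s + t) = \<sigma> s + \<sigma> t" if "s \<in> k" "t \<in> k" for s t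
    using \<tau> that by (simp add: \<sigma>_def field_embedding_def)
  have \<sigma>m: "\<sigma> (s * t) = \<sigma> s * \<sigma> t" if "s \<in> k" "t \<in> k" for s t
  proof -
    have "\<tau> (s * t) = \<tau> s * \<tau> t" using \<tau> that by (simp add: field_embedding_def)
    then show ?thesis using \<tau>\<sigma> that km by (metis of_real_eq_iff of_real_mult)
  qed
  have "field_embedding k \<sigma>"
    using \<sigma>1 \<sigma>a \<sigma>m by (simp add: field_embedding_def)
  moreover have "\<sigma> z \<noteq> z" using z \<tau>\<sigma> by auto
  ultimately obtain \<psi> where \<psi>: "hamilton_iso (\<sigma> \<alpha>) (\<sigma> \<beta>) \<psi>"
    using ram z(1) unfolding ramified_at_other_places_def by blast
  have \<sigma>0: "\<sigma> 0 = 0" using \<sigma>a[OF k0 k0] by simp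
  have \<sigma>z: "t = 0" if "t \<in> k" "\<sigma> t = 0" for t
  proof (rule ccontr)
    assume "t \<noteq> 0"
    then show False using \<sigma>m[OF that(1) ki[OF that(1)]] that \<sigma>1 by simp
  qed
  have xk: "x$i \<in> k" for i using x(1) by (simp add: quat_alg_def)
  define y :: "real^4" where "y = (\<chi> i. \<sigma> (x$i))"
  have "\<alpha> * (x$2 * x$2) + \<beta> * (x$3 * x$3) = \<alpha> * \<beta> * (x$4 * x$4)"
    using x(2,3) by (simp add: quat_norm_def power2_eq_square)
  then have "\<sigma> (\<alpha> * (x$2 * x$2) + \<beta> * (x$3 * x$3)) = \<sigma> (\<alpha> * \<beta> * (x$4 * x$4))"
    by simp
  then have "quat_norm (\<sigma> \<alpha>) (\<sigma> \<beta>) y = 0"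
    using ab xk x(2) by (simp add: \<sigma>a \<sigma>m km y_def quat_norm_def power2_eq_square \<sigma>0)
  moreover have "y$1 = 0" using x(2) \<sigma>0 by (simp add: y_def)
  ultimately have "y = 0" using hamilton_no_nilpotents[OF \<psi>] by blast
  then have "x = 0"
    using \<sigma>z xk by (simp add: y_def vec_eq_iff)
  then show False using x(4) by simp
qed

lemma quat_order_subset: "quat_order k \<alpha> \<beta> \<O> \<Longrightarrow> \<O> \<subseteq> quat_alg k"
  using lin_comb_mono[of "integers_of k" k] unfolding quat_order_def integers_of_def by blast

lemma rational_matrix_algebra_conj:
  assumes \<phi>: "split_iso \<alpha> \<beta> \<phi>" and ab: "\<alpha> \<in> \<rat>" "\<beta> \<in> \<rat>" and H: "det H = 1"
  shows "rational_matrix_algebra ((\<lambda>x. H ** \<phi> x ** adj2 H) ` quat_alg \<rat>)"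
proof -
  have lin: "linear \<phi>" and one: "\<phi> quat_one = mat 1"
    and mult: "\<phi> (quat_mult \<alpha> \<beta> x y) = \<phi> x ** \<phi> y" for x y
    using \<phi> by (auto simp: split_iso_def)
  let ?f = "\<lambda>x. H ** \<phi> x ** adj2 H"
  have tr: "trace (?f x) = 2 * x$1" for x
  proof -
    have "trace (?f x) = trace (adj2 H ** (H ** \<phi> x))" by (rule trace_mul_sym)
    also have "\<dots> = trace (\<phi> x)" by (simp add: matrix_mul_assoc adj2_mult H)
    finally show ?thesis using split_iso_trace_det[OF \<phi>] by simp
  qed
  have diff: "?f x - ?f y = ?f (x - y)" for x y
    using lin by (simp add: linear_diff mat2_simps algebra_simps)
  have scale: "q *\<^sub>R ?f x = ?f (q *\<^sub>R x)" for q x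
    using lin by (simp add: linear_scale mat2_simps algebra_simps)
  have prod: "?f x ** ?f y = ?f (quat_mult \<alpha> \<beta> x y)" for x y
  proof -
    have "?f x ** ?f y = H ** \<phi> x ** (adj2 H ** H) ** \<phi> y ** adj2 H"
      by (simp only: matrix_mul_assoc)
    then show ?thesis by (simp add: adj2_mult H mult matrix_mul_assoc)
  qed
  have Qd: "x - y \<in> quat_alg \<rat>" and Qm: "quat_mult \<alpha> \<beta> x y \<in> quat_alg \<rat>"
    if "x \<in> quat_alg \<rat>" "y \<in> quat_alg \<rat>" for x y
    using that ab by (auto simp: quat_alg_def forall_4 quat_mult_components)
  have Qs: "q *\<^sub>R x \<in> quat_alg \<rat>" if "x \<in> quat_alg \<rat>" "q \<in> \<rat>" for q x
    using that by (auto simp: quat_alg_def)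
  have Q1: "quat_one \<in> quat_alg \<rat>"
    by (simp add: quat_alg_def forall_4 quat_mult_components)
  have "mat 1 = ?f quat_one" by (simp add: one adj2_mult H)
  then show ?thesis
    unfolding rational_matrix_algebra_def using Qd Qm Qs Q1
    by (auto simp: diff scale prod tr quat_alg_def[of "\<rat>"] intro!: imageI)
qed

text \<open>Some power of the parabolic element comes, up to sign, from the order. Its pure part is
  a nonzero quaternion of norm zero, so \<open>k\<close> is \<rat>, and the conjugated rational
  algebra contains powers of all lifts.\<close>

lemma arithmetic_with_parabolic:
  assumes ar: "arithmetic \<Gamma>" and \<Gamma>: "subgroup \<Gamma> PSL2R" and X: "X \<in> \<Gamma>" "parabolic X"
  obtains \<A> where "rational_matrix_algebra \<A>"
    "\<And>M. det M = 1 \<Longrightarrow> to_PSL2R M \<in> \<Gamma> \<Longrightarrow> \<exists>n>0. M [^]\<^bsub>SL2R\<^esub> (n::nat) \<in> \<A>"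
proof -
  obtain k \<alpha> \<beta> \<phi> \<O> h where k: "real_number_field k" "totally_real k" and ab: "\<alpha> \<in> k" "\<beta> \<in> k"
    and \<phi>: "split_iso \<alpha> \<beta> \<phi>" and ram: "ramified_at_other_places k \<alpha> \<beta>" and \<O>: "quat_order k \<alpha> \<beta> \<O>"
    and h: "h \<in> carrier PSL2R"
    and comm: "commensurable PSL2R \<Gamma> (conjugate_set PSL2R h (norm_one_image \<alpha> \<beta> \<phi> \<O>))"
    using ar unfolding arithmetic_def by blast
  obtain H where H: "det H = 1" "h = to_PSL2R H" using h by (rule PSL2R_cases)
  have lin: "linear \<phi>" and one: "\<phi> quat_one = mat 1"
    using \<phi> by (auto simp: split_iso_def)
  let ?f = "\<lambda>x. H ** \<phi> x ** adj2 H"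
  let ?K = "conjugate_set PSL2R h (norm_one_image \<alpha> \<beta> \<phi> \<O>)"
  have K: "?K = (\<lambda>x. to_PSL2R (?f x)) ` {x \<in> \<O>. quat_norm \<alpha> \<beta> x = 1}"
    unfolding conjugate_set_def norm_one_image_def image_image H(2)
  proof (rule image_cong[OF refl])
    fix x assume "x \<in> {x \<in> \<O>. quat_norm \<alpha> \<beta> x = 1}"
    then have "det (\<phi> x) = 1" using split_iso_trace_det[OF \<phi>] by simp
    then show "to_PSL2R H \<otimes>\<^bsub>PSL2R\<^esub> to_PSL2R (\<phi> x) \<otimes>\<^bsub>PSL2R\<^esub> inv\<^bsub>PSL2R\<^esub> to_PSL2R H = to_PSL2R (?f x)"
      by (simp add: to_PSL2R_mult to_PSL2R_inv[symmetric] det_mul det_adj2 H(1))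
  qed
  have "quat_norm \<alpha> \<beta> quat_one = 1" "quat_one \<in> \<O>"
    using \<O> by (simp_all add: quat_norm_def quat_mult_components quat_order_def)
  then have "to_PSL2R (?f quat_one) \<in> ?K" unfolding K by blast
  then have one_K: "\<one>\<^bsub>PSL2R\<^esub> \<in> ?K"
    by (simp add: one adj2_mult H to_PSL2R_one)
  \<comment> \<open>Commensurability puts a power into the arithmetic group; the sign is the
    ambiguity of lifting from \<open>PSL2R\<close>.\<close>
  have pow: "\<exists>n>0. \<exists>x\<in>\<O>. quat_norm \<alpha> \<beta> x = 1 \<and> (M [^]\<^bsub>SL2R\<^esub> (n::nat) = ?f x \<or> M [^]\<^bsub>SL2R\<^esub> n = - ?f x)"
    if M: "det M = 1" "to_PSL2R M \<in> \<Gamma>" for M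
  proof -
    have "finite_index PSL2R (\<Gamma> \<inter> ?K) \<Gamma>" using comm by (simp add: commensurable_def)
    from PSL2R.finite_index_power[OF \<Gamma> one_K this M(2)]
    obtain n where n: "n > 0" "to_PSL2R (M [^]\<^bsub>SL2R\<^esub> (n::nat)) \<in> ?K"
      using to_PSL2R_pow[OF M(1)] by auto
    then obtain x where "x \<in> \<O>" "quat_norm \<alpha> \<beta> x = 1" "to_PSL2R (M [^]\<^bsub>SL2R\<^esub> n) = to_PSL2R (?f x)"
      unfolding K by blast
    then show ?thesis using n(1) by (auto simp: to_PSL2R_eq_iff)
  qed
  have "X \<in> carrier PSL2R" using X \<Gamma> subgroup.subset by blast
  then obtain P' where P': "det P' = 1" "X = to_PSL2R P'" by (rule PSL2R_cases)
  then have "\<bar>trace P'\<bar> = 2" using X(2) by (simp add: parabolic_def to_PSL2R_eq)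
  \<comment> \<open>A change of sign of the lift makes it unipotent, so that its powers are
    explicit.\<close>
  then have "trace P' = 2 \<or> trace (- P') = 2" by (auto simp: trace_def sum_2)
  then obtain P where P: "det P = 1" "X = to_PSL2R P" "trace P = 2"
    using P' by (metis det_uminus2 minus_minus to_PSL2R_eq_iff)
  define N where "N = P - mat 1"
  have PN: "P = mat 1 + N" by (simp add: N_def)
  have trN: "trace N = 0" and "det N = 0"
    using P(1,3) by (simp_all add: N_def mat2_simps algebra_simps)
  then have NN: "N ** N = 0" by (simp add: cayley_hamilton2)
  have "N \<noteq> 0" using X(2) P(2) PN by (auto simp: parabolic_def to_PSL2R_one)
  obtain n x where n: "n > 0" and x: "x \<in> \<O>" "quat_norm \<alpha> \<beta> x = 1"
    and Pn: "P [^]\<^bsub>SL2R\<^esub> (n::nat) = ?f x \<or> P [^]\<^bsub>SL2R\<^esub> n = - ?f x"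
    using pow[of P] P X by auto
  obtain \<epsilon> :: real where \<epsilon>: "\<epsilon> = 1 \<or> \<epsilon> = -1" and fx: "?f x = \<epsilon> *\<^sub>R (mat 1 + real n *\<^sub>R N)"
  proof -
    have "?f x = 1 *\<^sub>R (mat 1 + real n *\<^sub>R N) \<or> ?f x = (-1) *\<^sub>R (mat 1 + real n *\<^sub>R N)"
      using Pn unfolding PN unipotent_pow[OF NN] scaleR_one scaleR_minus1_left
      by (metis minus_minus)
    then show ?thesis using that by blast
  qed
  have \<phi>x: "\<phi> x = adj2 H ** ?f x ** H"
  proof -
    have "adj2 H ** ?f x ** H = (adj2 H ** H) ** \<phi> x ** (adj2 H ** H)"
      by (simp only: matrix_mul_assoc)
    then show ?thesis by (simp add: adj2_mult H)
  qed
  have "trace (\<phi> x) = trace (adj2 H ** ?f x ** H)"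
    by (rule arg_cong[OF \<phi>x])
  also have "\<dots> = trace (H ** (adj2 H ** ?f x))"
    by (rule trace_mul_sym)
  also have "\<dots> = trace (?f x)" by (simp add: matrix_mul_assoc adj2_mult H)
  also have "\<dots> = \<epsilon> * (2 + real n * trace N)"
    unfolding fx by (simp add: trace_def sum_2 mat_def algebra_simps)
  finally have x1: "x$1 = \<epsilon>" using split_iso_trace_det[OF \<phi>] trN by simp
  \<comment> \<open>Under \<phi> and conjugation by \<open>H\<close> this becomes \<epsilon> times
    \<open>n N\<close>, a nonzero nilpotent matrix.\<close>
  define y where "y = x - \<epsilon> *\<^sub>R quat_one"
  have "y \<noteq> 0"
  proof
    assume "y = 0"
    then have "\<phi> x = \<epsilon> *\<^sub>R mat 1" using lin one by (simp add: y_def linear_scale)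
    then have "?f x = \<epsilon> *\<^sub>R (H ** adj2 H)"
      by (simp add: mat2_simps algebra_simps)
    then have "?f x = \<epsilon> *\<^sub>R mat 1"
      by (simp add: adj2_mult H)
    then show False using fx \<epsilon> n \<open>N \<noteq> 0\<close> by auto
  qed
  moreover have "y$1 = 0" "quat_norm \<alpha> \<beta> y = 0"
    using x(2) x1 \<epsilon> by (auto simp: y_def quat_mult_components quat_norm_def)
  moreover have "y \<in> quat_alg k"
  proof -
    have "x \<in> quat_alg k" using x(1) quat_order_subset[OF \<O>] by blast
    moreover have "1 \<in> k" "\<And>s t. s \<in> k \<Longrightarrow> t \<in> k \<Longrightarrow> s - t \<in> k"
      using k(1) by (auto simp: real_number_field_def)
    moreover have "0 \<in> k" using calculation(2,3) by (metis diff_self)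
    ultimately show ?thesis
      using \<open>y$1 = 0\<close> by (simp add: quat_alg_def forall_4 y_def quat_mult_components)
  qed
  ultimately have kQ: "k \<subseteq> \<rat>"
    using isotropic_imp_rational[OF k ab ram] by blast
  then have \<O>Q: "\<O> \<subseteq> quat_alg \<rat>"
    using quat_order_subset[OF \<O>] by (auto simp: quat_alg_def)
  have alg: "rational_matrix_algebra (?f ` quat_alg \<rat>)"
    using rational_matrix_algebra_conj[OF \<phi> _ _ H(1)] ab kQ by blast
  have "\<exists>n>0. M [^]\<^bsub>SL2R\<^esub> (n::nat) \<in> ?f ` quat_alg \<rat>" if M: "det M = 1" "to_PSL2R M \<in> \<Gamma>" for M
  proof -
    obtain n x where n: "n > 0" "x \<in> \<O>" "M [^]\<^bsub>SL2R\<^esub> (n::nat) = ?f x \<or> M [^]\<^bsub>SL2R\<^esub> n = - ?f x"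
      using pow[OF M] by blast
    moreover have "?f x \<in> ?f ` quat_alg \<rat>" using n \<O>Q by blast
    \<comment> \<open>The sign ambiguity is harmless because the algebra is closed under
      negation.\<close>
    moreover have "(-1) *\<^sub>R ?f x \<in> ?f ` quat_alg \<rat>"
    proof -
      have "(-1 :: real) \<in> \<rat>" by simp
      then show ?thesis
        using alg calculation(4) unfolding rational_matrix_algebra_def by blast
    qed
    ultimately show ?thesis by (metis scaleR_minus1_left)
  qed
  with alg that show thesis by blast
qed

section \<open>Translation lengths\<close>

lemma act_to_PSL2R: "act (to_PSL2R M) z = moebius M z"
proof -
  have "moebius (- M) z = moebius M z"
    using minus_divide_divide[of "of_real (M$1$1) * z + of_real (M$1$2)" "of_real (M$2$1) * z + of_real (M$2$2)"]
    by (simp add: moebius_def)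
  then show ?thesis by (simp add: act_def to_PSL2R_eq)
qed

lemma moebius_denom_nonzero:
  fixes M :: "real^2^2"
  assumes "det M = 1" "Im z > 0"
  shows "of_real (M$2$1) * z + of_real (M$2$2) \<noteq> 0"
proof
  assume "of_real (M$2$1) * z + of_real (M$2$2) = 0"
  then have "M$2$1 * Im z = 0" "M$2$1 * Re z + M$2$2 = 0"
    by (simp_all add: complex_eq_iff)
  then have "M$2$1 = 0" "M$2$2 = 0" using assms by auto
  then show False using assms by (simp add: det_2)
qed

lemma moebius_mult:
  assumes "det N = 1" "Im z > 0"
  shows "moebius (M ** N) z = moebius M (moebius N z)"
proof -
  let ?d = "of_real (N$2$1) * z + of_real (N$2$2)"
  let ?n = "of_real (N$1$1) * z + of_real (N$1$2)"
  have d: "?d \<noteq> 0" by (rule moebius_denom_nonzero[OF assms])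
  have "moebius M (moebius N z) = (of_real (M$1$1) * ?n + of_real (M$1$2) * ?d) / (of_real (M$2$1) * ?n + of_real (M$2$2) * ?d)"
  proof -
    have "of_real p * (?n / ?d) + of_real q = (of_real p * ?n + of_real q * ?d) / ?d" for p q
      using d by (simp add: field_simps)
    then show ?thesis using d by (simp add: moebius_def)
  qed
  also have "\<dots> = moebius (M ** N) z"
    by (simp add: moebius_def mat2_simps algebra_simps)
  finally show ?thesis by simp
qed

lemma Im_moebius:
  assumes "det M = 1"
  shows "Im (moebius M z) = Im z / (cmod (of_real (M$2$1) * z + of_real (M$2$2)))\<^sup>2"
proof -
  have "(M$1$1 * M$2$2 - M$1$2 * M$2$1) * Im z = Im z"
    using assms by (simp add: det_2)
  then show ?thesis
    by (simp add: moebius_def Im_divide cmod_power2 algebra_simps)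
qed

lemma Im_moebius_pos: "det M = 1 \<Longrightarrow> Im z > 0 \<Longrightarrow> Im (moebius M z) > 0"
  using moebius_denom_nonzero[of M z] by (simp add: Im_moebius)

lemma hyp_dist_moebius:
  assumes M: "det M = 1" and z: "Im z > 0" and w: "Im w > 0"
  shows "hyp_dist (moebius M z) (moebius M w) = hyp_dist z w"
proof -
  let ?d = "\<lambda>z. of_real (M$2$1) * z + of_real (M$2$2)"
  note nz = moebius_denom_nonzero[OF M z] moebius_denom_nonzero[OF M w]
  have "moebius M z - moebius M w = of_real (det M) * (z - w) / (?d z * ?d w)"
    using nz by (simp add: moebius_def divide_simps det_2) (simp add: algebra_simps)
  then have "(cmod (moebius M z - moebius M w))\<^sup>2 = (cmod (z - w))\<^sup>2 / ((cmod (?d z))\<^sup>2 * (cmod (?d w))\<^sup>2)"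
    using M by (simp add: norm_divide norm_mult power_divide power_mult_distrib)
  then show ?thesis
    unfolding hyp_dist_def Im_moebius[OF M] using nz by simp
qed

lemma hyp_dist_imaginary_axis: "hyp_dist (\<i> * of_real (exp s)) (\<i> * of_real (exp t)) = \<bar>s - t\<bar>"
proof -
  have "\<i> * of_real (exp s) - \<i> * of_real (exp t) = \<i> * complex_of_real (exp s - exp t)"
    by (simp add: algebra_simps)
  then have n: "cmod (\<i> * of_real (exp s) - \<i> * of_real (exp t)) = \<bar>exp s - exp t\<bar>"
    by (simp only: norm_mult norm_ii norm_of_real)  simp
  have "1 + (exp s - exp t)\<^sup>2 / (2 * exp s * exp t) = cosh (s - t)"
    by (simp add: cosh_def exp_diff exp_minus field_simps power2_eq_square)
  then have "hyp_dist (\<i> * of_real (exp s)) (\<i> * of_real (exp t)) = arcosh (cosh \<bar>s - t\<bar>)"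
    unfolding hyp_dist_def n by simp
  then show ?thesis by (simp only: arcosh_cosh_real abs_ge_zero)
qed

text \<open>The quadratic polynomial of \<open>M\<^sup>2 = tr(M) M - 1\<close> is \<open>tr M\<close> times that of \<open>M\<close>. Comparing the
  displacements under \<open>M\<close> and \<open>M\<^sup>2\<close> therefore determines the translation length.\<close>

lemma cosh_hyp_dist_displacement:
  assumes M: "det M = 1" and z: "Im z > 0"
  shows "cosh (hyp_dist z (moebius M z)) = 1 +
    (cmod (of_real (M$2$1) * z\<^sup>2 + of_real (M$2$2 - M$1$1) * z - of_real (M$1$2)))\<^sup>2 / (2 * (Im z)\<^sup>2)"
proof -
  let ?d = "of_real (M$2$1) * z + of_real (M$2$2)"
  let ?q = "of_real (M$2$1) * z\<^sup>2 + of_real (M$2$2 - M$1$1) * z - of_real (M$1$2)"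
  have d: "?d \<noteq> 0" by (rule moebius_denom_nonzero[OF M z])
  have "z - moebius M z = ?q / ?d"
    using d by (simp add: moebius_def divide_simps) (simp add: algebra_simps power2_eq_square)
  then have n: "(cmod (z - moebius M z))\<^sup>2 = (cmod ?q)\<^sup>2 / (cmod ?d)\<^sup>2"
    by (simp add: norm_divide power_divide)
  have "(cmod (z - moebius M z))\<^sup>2 / (2 * Im z * Im (moebius M z)) = (cmod ?q)\<^sup>2 / (2 * (Im z)\<^sup>2)"
    unfolding n Im_moebius[OF M] using d by (simp add: power2_eq_square)
  moreover have "cosh (arcosh (1 + (cmod ?q)\<^sup>2 / (2 * (Im z)\<^sup>2))) = 1 + (cmod ?q)\<^sup>2 / (2 * (Im z)\<^sup>2)"
    by (rule cosh_arcosh_real) simp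
  ultimately show ?thesis unfolding hyp_dist_def by simp
qed

lemma closed_geodesic_trace:
  assumes M: "det M = 1" and L: "closed_geodesic_of_length (to_PSL2R M) L"
  shows "2 * cosh (L / 2) = \<bar>trace M\<bar>"
proof -
  obtain c where "L > 0" and geo: "geodesic_line c" and tr: "\<And>t. moebius M (c t) = c (t + L)"
    using L by (auto simp: closed_geodesic_of_length_def act_to_PSL2R)
  have dist: "hyp_dist (c s) (c t) = \<bar>s - t\<bar>" and pos: "Im (c t) > 0" for s t
    using geo by (auto simp: geodesic_line_def upper_half_plane_def)
  let ?q = "\<lambda>M z. of_real (M$2$1) * z\<^sup>2 + of_real (M$2$2 - M$1$1) * z - of_real (M$1$2)"
  define K where "K = (cmod (?q M (c 0)))\<^sup>2 / (2 * (Im (c 0))\<^sup>2)"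
  have 1: "cosh L = 1 + K"
    using cosh_hyp_dist_displacement[OF M pos[of 0]] tr[of 0] dist[of 0 L] by (simp add: K_def)
  have MM: "det (M ** M) = 1" using M by (simp add: det_mul)
  have "?q (M ** M) z = of_real (trace M) * ?q M z" for z :: complex
    by (simp add: mat2_simps algebra_simps)
  then have "(cmod (?q (M ** M) z))\<^sup>2 = (trace M)\<^sup>2 * (cmod (?q M z))\<^sup>2" for z :: complex
    by (simp only: norm_mult norm_of_real power_mult_distrib power2_abs)
  moreover have "moebius (M ** M) (c 0) = c (2 * L)"
    using moebius_mult[OF M pos[of 0]] tr[of 0] tr[of L] by simp
  ultimately have 2: "cosh (2 * L) = 1 + (trace M)\<^sup>2 * K"
    using cosh_hyp_dist_displacement[OF MM pos[of 0]] dist[of 0 "2 * L"] by (simp add: K_def)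
  have "cosh (2 * L) = 2 * (cosh L)\<^sup>2 - 1"
    by (simp add: cosh_double_cosh)
  \<comment> \<open>Double-angle formula with \<open>cosh L = 1 + K\<close> and
    \<open>cosh (2 * L) = 1 + (trace M)^2 * K\<close>; the positive length then excludes
    \<open>K = 0\<close>.\<close>
  then have "K * ((trace M)\<^sup>2 - 4 - 2 * K) = 0"
    using 1 2 by (simp add: power2_eq_square algebra_simps)
  moreover have "K \<noteq> 0"
    using 1 \<open>L > 0\<close> cosh_real_one_iff[of L] by auto
  ultimately have "(trace M)\<^sup>2 = 2 * (cosh L + 1)"
    using 1 by simp
  also have "cosh L = 2 * (cosh (L / 2))\<^sup>2 - 1"
    using cosh_double_cosh[of "L / 2"] by simp
  finally have "(trace M)\<^sup>2 = (2 * cosh (L / 2))\<^sup>2"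
    by (simp add: power_mult_distrib)
  then have "trace M = 2 * cosh (L / 2) \<or> trace M = - (2 * cosh (L / 2))"
    by (simp only: power2_eq_iff)
  then show ?thesis using cosh_real_pos[of "L / 2"] by auto
qed

lemma hyperbolic_diagonalizable:
  fixes M :: "real^2^2"
  assumes M: "det M = 1" and tr: "trace M = l + m" "l * m = 1" "l \<noteq> m"
  obtains P where "det P = 1" "M ** P = P ** (\<chi> i j. if i = j then if i = 1 then l else m else 0)"
proof -
  \<comment> \<open>\<open>\<delta> w\<close> is the determinant of \<open>w\<close> and \<open>M w\<close>. If it is nonzero, \<open>M w - m w\<close> and \<open>M w - l w\<close> are
    independent eigenvectors.\<close>
  define \<delta> where "\<delta> w = w$1 * (M *v w)$2 - w$2 * (M *v w)$1" for w :: "real^2"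
  have "\<exists>w. \<delta> w \<noteq> 0"
  proof (rule ccontr)
    assume "\<nexists>w. \<delta> w \<noteq> 0"
    then have z: "\<delta> (vector [x, y]) = 0" for x y by blast
    \<comment> \<open>Vanishing at both basis vectors and at their sum forces \<open>M\<close> to be
      scalar, which contradicts distinct eigenvalues.\<close>
    have "M$2$1 = 0" "M$1$2 = 0" "M$1$1 = M$2$2"
      using z[of 1 0] z[of 0 1] z[of 1 1]
      by (simp_all add: \<delta>_def matrix_vector_mult_def sum_2)
    then have "M$1$1 * M$1$1 = 1" "2 * M$1$1 = l + m"
      using M tr by (simp_all add: det_2 trace_def sum_2)
    then have "(l + m)\<^sup>2 = 4"
      by (metis (no_types, opaque_lifting) mult.left_commute mult.assoc mult_2_right numeral_Bit0 power2_eq_square mult.right_neutral one_add_one)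
    then have "(l - m)\<^sup>2 = 0"
      using tr(2) by (simp add: power2_eq_square algebra_simps)
    then show False using tr(3) by simp
  qed
  then obtain w where w: "\<delta> w \<noteq> 0" by blast
  \<comment> \<open>Rescaling one eigenvector gives \<open>P\<close> determinant one, orientation
    included.\<close>
  define k where "k = 1 / ((l - m) * \<delta> w)"
  define P :: "real^2^2" where "P = (\<chi> i j. if j = 1 then k * ((M *v w)$i - m * w$i) else (M *v w)$i - l * w$i)"
  have "det P = k * ((l - m) * \<delta> w)"
    by (simp add: P_def det_2 \<delta>_def algebra_simps)
  then have "det P = 1" using w tr by (simp add: k_def)
  moreover have "M ** P = P ** (\<chi> i j. if i = j then if i = 1 then l else m else 0)"
  proof -
    have "M ** M = (l + m) *\<^sub>R M - (l * m) *\<^sub>R mat 1"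
      using M tr cayley_hamilton2[of M] by simp
    then have "(M ** M) *v w = ((l + m) *\<^sub>R M - (l * m) *\<^sub>R mat 1) *v w"
      by simp
    also have "\<dots> = (l + m) *\<^sub>R (M *v w) - (l * m) *\<^sub>R w"
      by (simp add: vec_eq_iff forall_2 matrix_vector_mult_def sum_2 mat_def algebra_simps)
    finally have CH: "(M ** M) *v w = (l + m) *\<^sub>R (M *v w) - (l * m) *\<^sub>R w" .
    have MMw: "M$i$1 * (M *v w)$1 + M$i$2 * (M *v w)$2 = (l + m) * (M *v w)$i - l * m * w$i" for i
      using arg_cong[OF CH, of "\<lambda>v. v$i"]
      by (simp add: matrix_vector_mul_assoc[symmetric] matrix_vector_mult_def[of M "M *v w"] sum_2)
    have Mw: "M$i$1 * w$1 + M$i$2 * w$2 = (M *v w)$i" for i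
      by (simp add: matrix_vector_mult_def sum_2)
    have "M$i$1 * (k * ((M *v w)$1 - m * w$1)) + M$i$2 * (k * ((M *v w)$2 - m * w$2)) = k * ((M *v w)$i - m * w$i) * l" for i
    proof -
      have "M$i$1 * (k * ((M *v w)$1 - m * w$1)) + M$i$2 * (k * ((M *v w)$2 - m * w$2)) =
        k * ((M$i$1 * (M *v w)$1 + M$i$2 * (M *v w)$2) - m * (M$i$1 * w$1 + M$i$2 * w$2))"
        by (simp add: algebra_simps)
      then show ?thesis unfolding MMw Mw by (simp add: algebra_simps)
    qed
    moreover have "M$i$1 * ((M *v w)$1 - l * w$1) + M$i$2 * ((M *v w)$2 - l * w$2) = ((M *v w)$i - l * w$i) * m" for i
    proof -
      have "M$i$1 * ((M *v w)$1 - l * w$1) + M$i$2 * ((M *v w)$2 - l * w$2) =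
        (M$i$1 * (M *v w)$1 + M$i$2 * (M *v w)$2) - l * (M$i$1 * w$1 + M$i$2 * w$2)"
        by (simp add: algebra_simps)
      then show ?thesis unfolding MMw Mw by (simp add: algebra_simps)
    qed
    ultimately show ?thesis
      by (simp add: P_def vec_eq_iff forall_2 matrix_matrix_mult_def sum_2)
  qed
  ultimately show thesis by (rule that)
qed

text \<open>The diagonal form translates the imaginary axis by \<open>L\<close>; the diagonalizing
  matrix carries that axis to the axis of \<open>M\<close>. The choice of \<open>L\<close> makes the
  eigenvalues \<open>exp (L / 2)\<close> and \<open>exp (- (L / 2))\<close>.\<close>

lemma closed_geodesic_exists:
  assumes M: "det M = 1" and tr: "trace M > 2"
  shows "\<exists>L. closed_geodesic_of_length (to_PSL2R M) L"
proof -
  define L where "L = 2 * arcosh (trace M / 2)"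
  have "L > 0" using tr by (simp add: L_def)
  have "cosh (L / 2) = trace M / 2" using tr by (simp add: L_def)
  then have trM: "trace M = exp (L / 2) + exp (- (L / 2))" by (simp add: cosh_def)
  have "exp (L / 2) * exp (- (L / 2)) = 1" "exp (L / 2) \<noteq> exp (- (L / 2))"
    using \<open>L > 0\<close> by (simp_all flip: exp_add)
  from hyperbolic_diagonalizable[OF M trM this] obtain P where P: "det P = 1"
    "M ** P = P ** (\<chi> i j. if i = j then if i = 1 then exp (L / 2) else exp (- (L / 2)) else 0)" (is "_ = _ ** ?D") .
  have D: "det ?D = 1" by (simp add: det_2 flip: exp_add)
  define c where "c t = moebius P (\<i> * of_real (exp t))" for t
  have pos: "Im (\<i> * of_real (exp t)) > 0" for t :: real by simp
  have "geodesic_line c"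
    unfolding geodesic_line_def c_def upper_half_plane_def
    using Im_moebius_pos[OF P(1) pos] hyp_dist_moebius[OF P(1) pos pos] hyp_dist_imaginary_axis
    by auto
  moreover have "act (to_PSL2R M) (c t) = c (t + L)" for t
  proof -
    have "moebius ?D (\<i> * of_real (exp t)) = \<i> * of_real (exp (t + L))"
    proof -
      have "exp L = exp (L / 2) * exp (L / 2)" by (simp flip: exp_add)
      then show ?thesis by (simp add: moebius_def exp_add exp_minus field_simps)
    qed
    then show ?thesis
      using moebius_mult[OF P(1) pos[of t], of M] moebius_mult[OF D pos[of t], of P]
      by (simp add: act_to_PSL2R c_def P(2))
  qed
  ultimately show ?thesis
    using \<open>L > 0\<close> unfolding closed_geodesic_of_length_def by blast
qed

text \<open>Bridge from geometry to algebra. The length is well defined because the trace fixes its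
  hyperbolic cosine and lengths are positive.\<close>

lemma Tr_eq_trace:
  assumes M: "det M = 1" and x: "\<rho> x = to_PSL2R M" and tr: "\<bar>trace M\<bar> > 2"
  shows "Tr \<rho> x = \<bar>trace M\<bar>"
proof -
  have "\<exists>N. det N = 1 \<and> to_PSL2R N = to_PSL2R M \<and> trace N > 2"
  proof (cases "trace M > 2")
    case False
    then have "trace (- M) > 2" using tr by (simp add: trace_def sum_2 abs_if split: if_splits)
    then show ?thesis using M by (intro exI[of _ "- M"]) (simp add: det_uminus2 to_PSL2R_eq_iff)
  qed (use M in blast)
  then obtain L where L: "closed_geodesic_of_length (to_PSL2R M) L"
    using closed_geodesic_exists by metis
  have uniq: "L' = L" if L': "closed_geodesic_of_length (to_PSL2R M) L'" for L'
  proof -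
    have "\<bar>L'\<bar> = \<bar>L\<bar>"
      using closed_geodesic_trace[OF M L] closed_geodesic_trace[OF M L']
      by (auto dest: sym)
    moreover have "L > 0" "L' > 0"
      using L L' unfolding closed_geodesic_of_length_def by blast+
    ultimately show ?thesis by simp
  qed
  have "(THE L. closed_geodesic_of_length (to_PSL2R M) L) = L"
    using L uniq by (rule the_equality)
  then have "geodesic_length \<rho> x = L"
    unfolding geodesic_length_def x using L by metis
  then show ?thesis using closed_geodesic_trace[OF M L] by (simp add: Tr_def)
qed

section \<open>Pairs of free generators\<close>

text \<open>Trace 2 is the reducible case, in which commutators are unipotent and commute. The
  argument is by traces alone, without producing a common eigenvector.\<close>

lemma commutator_commutes_with_conjugate:
  fixes A B :: "real^2^2"
  defines "C \<equiv> A ** B ** adj2 A ** adj2 B"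
  assumes A: "det A = 1" and B: "det B = 1" and tr: "trace C = 2"
  shows "C ** (A ** C ** adj2 A) = (A ** C ** adj2 A) ** C"
proof -
  define N where "N = C - mat 1"
  have detC: "det C = 1" unfolding C_def using A B by (simp add: det_mul det_adj2)
  have CN: "C = mat 1 + N" by (simp add: N_def)
  have trN: "trace N = 0" and detN: "det N = 0"
    using tr detC by (simp_all add: N_def mat2_simps algebra_simps)
  \<comment> \<open>\<open>N\<close> has rank one, so \<open>N X N = tr(X N) N\<close>, and the traces in question vanish.\<close>
  have NXN: "N ** X ** N = trace (X ** N) *\<^sub>R N - det N *\<^sub>R adj2 X" for X
    by (simp add: adj2_def mat2_simps algebra_simps)
  \<comment> \<open>\<open>adj2 A ** C\<close> is the conjugate of \<open>adj2 A\<close> by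
    \<open>B\<close>, so both have the same trace.\<close>
  have "adj2 A ** C = (adj2 A ** A) ** B ** adj2 A ** adj2 B"
    by (simp only: C_def matrix_mul_assoc)
  also have "\<dots> = B ** adj2 A ** adj2 B" by (simp add: adj2_mult A)
  finally have "trace (adj2 A ** C) = trace (B ** (adj2 A ** adj2 B))"
    by (simp only: matrix_mul_assoc)
  also have "\<dots> = trace (adj2 A ** adj2 B ** B)" by (rule trace_mul_sym)
  also have "\<dots> = trace (adj2 A)"
    by (simp only: matrix_mul_assoc[symmetric] adj2_mult B) simp
  finally have "trace (adj2 A ** C) = trace (adj2 A)" .
  moreover have "trace (adj2 A ** N) = trace (adj2 A ** C) - trace (adj2 A)"
    by (simp add: N_def mat2_simps algebra_simps)
  ultimately have tr': "trace (adj2 A ** N) = 0" by simp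
  have "trace (A ** N) = trace A * trace N - trace (adj2 A ** N)"
    by (simp add: adj2_def mat2_simps algebra_simps)
  then have "trace (A ** N) = 0" using trN tr' by simp
  then have z: "N ** A ** N = 0" "N ** adj2 A ** N = 0"
    using tr' by (simp_all add: NXN detN)
  have distrib: "X ** (Y + Z) = X ** Y + X ** Z" "(X + Y) ** Z = X ** Z + Y ** Z"
    "X ** 0 = 0" "0 ** X = 0" for X Y Z :: "real^2^2"
    by (simp_all add: mat2_simps algebra_simps)
  have D: "A ** C ** adj2 A = mat 1 + A ** N ** adj2 A"
    unfolding CN using adj2_mult(1)[of A] A by (simp add: distrib)
  have "N ** (A ** N ** adj2 A) = (N ** A ** N) ** adj2 A"
    "(A ** N ** adj2 A) ** N = A ** (N ** adj2 A ** N)"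
    by (simp_all only: matrix_mul_assoc)
  then show ?thesis
    unfolding D unfolding CN using z by (simp add: distrib)
qed

text \<open>Fricke's identity. Made homogeneous by determinants, it is a polynomial identity in the
  entries.\<close>

lemma trace_commutator:
  fixes A B :: "real^2^2"
  assumes "det A = 1" "det B = 1"
  shows "trace (A ** B ** adj2 A ** adj2 B) =
    (trace A)\<^sup>2 + (trace B)\<^sup>2 + (trace (A ** B))\<^sup>2 - trace A * trace B * trace (A ** B) - 2"
proof -
  have "trace (A ** B ** adj2 A ** adj2 B) =
    (trace A)\<^sup>2 * det B + (trace B)\<^sup>2 * det A + (trace (A ** B))\<^sup>2 - trace A * trace B * trace (A ** B) - 2 * det A * det B"
    by (simp add: adj2_def mat2_simps power2_eq_square algebra_simps)
  then show ?thesis using assms by simp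
qed

lemma det_matrix_commutator:
  fixes A B :: "real^2^2"
  assumes "det A = 1" "det B = 1"
  shows "det (A ** B - B ** A) = 2 - trace (A ** B ** adj2 A ** adj2 B)"
proof -
  have "det (A ** B - B ** A) = 2 * det A * det B - trace (A ** B ** adj2 A ** adj2 B)"
    by (simp add: adj2_def mat2_simps power2_eq_square algebra_simps)
  then show ?thesis using assms by simp
qed

text \<open>For \<bar>x\<bar> at most 2 the right side is at most \<open>2 \<bar>y z\<bar>\<close>,
  hence at most the sum of the squares of \<open>y\<close> and \<open>z\<close>, leaving no room for
  a nonzero \<open>x\<close>.\<close>

lemma markov_solution_gt_2:
  fixes x y z :: real
  assumes eq: "x\<^sup>2 + y\<^sup>2 + z\<^sup>2 = x * y * z" and "x \<noteq> 0"
  shows "\<bar>x\<bar> > 2"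
proof (rule ccontr)
  assume "\<not> \<bar>x\<bar> > 2"
  then have "\<bar>x\<bar> * \<bar>y * z\<bar> \<le> 2 * \<bar>y * z\<bar>"
    by (intro mult_right_mono) auto
  moreover have "2 * \<bar>y * z\<bar> \<le> y\<^sup>2 + z\<^sup>2"
    using sum_squares_bound[of "\<bar>y\<bar>" "\<bar>z\<bar>"] by (simp add: abs_mult)
  moreover have "x * y * z \<le> \<bar>x\<bar> * \<bar>y * z\<bar>"
    by (metis abs_ge_self abs_mult mult.assoc)
  ultimately have "x\<^sup>2 \<le> 0" using eq by linarith
  then show False using \<open>x \<noteq> 0\<close> by simp
qed

text \<open>Rational root theorem: such a root would be an integer dividing 4, and beyond 2 only 3
  and 4 have to be tested.\<close>

lemma quintic_no_rational_root:
  fixes x :: real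
  assumes "x \<in> \<rat>" "x > 2"
  shows "x ^ 5 - 2 * x ^ 4 - 4 * x ^ 3 + 3 * x\<^sup>2 + 4 * x - 4 \<noteq> 0"
proof
  assume eq: "x ^ 5 - 2 * x ^ 4 - 4 * x ^ 3 + 3 * x\<^sup>2 + 4 * x - 4 = 0"
  let ?p = "[:-4, 4, 3, -4, -2, 1:] :: real poly"
  have "poly ?p x = 0"
    using eq by (simp add: eval_nat_numeral algebra_simps)
  moreover have "coeff ?p i \<in> \<int>" for i
    by (auto simp: coeff_pCons split: nat.split)
  ultimately have "algebraic_int x"
    by (intro algebraic_int.intros[of ?p]) auto
  then obtain n where n: "x = of_int n"
    using rational_algebraic_int_is_int[OF _ assms(1)] by (auto elim: Ints_cases)
  have "of_int (n * (n ^ 4 - 2 * n ^ 3 - 4 * n\<^sup>2 + 3 * n + 4)) = (of_int 4 :: real)"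
    using eq unfolding n by (simp add: eval_nat_numeral algebra_simps)
  then have n4: "n * (n ^ 4 - 2 * n ^ 3 - 4 * n\<^sup>2 + 3 * n + 4) = 4"
    by (simp only: of_int_eq_iff)
  then have "n dvd 4" by (metis dvd_triv_left)
  then have "n \<le> 4" by (rule zdvd_imp_le) simp
  moreover have "n > 2" using assms(2) n by simp
  ultimately have "n = 3 \<or> n = 4" by linarith
  then show False using n4 by auto
qed

section \<open>Words in the free group\<close>

lemma reduced_word_simps:
  "reduced_word []" "reduced_word [l]"
  "reduced_word (l # m # w) \<longleftrightarrow> \<not> (fst l = fst m \<and> snd l \<noteq> snd m) \<and> reduced_word (m # w)"
proof -
  have "(\<forall>i. P i) \<longleftrightarrow> P 0 \<and> (\<forall>i. P (Suc i))" for P :: "nat \<Rightarrow> bool"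
    by (metis not0_implies_Suc)
  from this[of "\<lambda>i. Suc i < length (l # m # w) \<longrightarrow>
      \<not> (fst ((l # m # w) ! i) = fst ((l # m # w) ! Suc i) \<and> snd ((l # m # w) ! i) \<noteq> snd ((l # m # w) ! Suc i))"]
  show "reduced_word (l # m # w) \<longleftrightarrow> \<not> (fst l = fst m \<and> snd l \<noteq> snd m) \<and> reduced_word (m # w)"
    unfolding reduced_word_def by simp
qed (simp_all add: reduced_word_def)

text \<open>Excludes lifts of trace zero, which have order two modulo sign.\<close>

lemma free_generators_square:
  fixes G (structure)
  assumes "free_generators G a b"
  shows "a \<otimes>\<^bsub>G\<^esub> a \<noteq> \<one>\<^bsub>G\<^esub>"
proof -
  interpret group G using assms by (simp add: free_generators_def)
  have "a \<in> carrier G" using assms by (simp add: free_generators_def)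
  then have "word_value G a b [(True, True), (True, True)] = a \<otimes>\<^bsub>G\<^esub> a"
    by (simp add: word_value_def letter_def)
  moreover have "reduced_word [(True, True), (True, True)]"
    by (simp add: reduced_word_simps)
  ultimately show ?thesis
    using assms unfolding free_generators_def by (metis list.distinct(1))
qed

text \<open>Freeness rules out the relation that commutator trace 2 would impose on the
  matrices.\<close>

lemma free_generators_commutator:
  fixes G (structure)
  assumes free: "free_generators G a b"
  defines "c \<equiv> commutator G a b"
  defines "d \<equiv> a \<otimes>\<^bsub>G\<^esub> c \<otimes>\<^bsub>G\<^esub> inv\<^bsub>G\<^esub> a"
  shows "c \<otimes>\<^bsub>G\<^esub> d \<noteq> d \<otimes>\<^bsub>G\<^esub> c"
proof
  interpret group G using free by (simp add: free_generators_def)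
  have ab [simp]: "a \<in> carrier G" "b \<in> carrier G" using free by (simp_all add: free_generators_def)
  assume eq: "c \<otimes> d = d \<otimes> c"
  have cancel: "inv x \<otimes> (x \<otimes> y) = y" "x \<otimes> (inv x \<otimes> y) = y" if "x \<in> carrier G" "y \<in> carrier G" for x y
    using that by (simp_all flip: m_assoc)
  define e where "e = b \<otimes> (a \<otimes> (a \<otimes> (inv b \<otimes> (inv a \<otimes> inv a))))"
  let ?a = "(True, True)" and ?b = "(False, True)" and ?A = "(True, False)" and ?B = "(False, False)"
  \<comment> \<open>the reduced form of \<open>c d (d c)\<^sup>-\<^sup>1\<close>, with \<open>e = (d c)\<^sup>-\<^sup>1\<close>\<close>
  let ?w = "[?a, ?b, ?A, ?B, ?a, ?a, ?b, ?A, ?B, ?A, ?b, ?a, ?a, ?B, ?A, ?A]"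
  have "word_value G a b ?w = c \<otimes> d \<otimes> e"
    by (simp add: word_value_def letter_def c_def d_def e_def commutator_def m_assoc cancel)
  also have "\<dots> = d \<otimes> c \<otimes> e" by (simp only: eq)
  also have "\<dots> = \<one>"
    by (simp add: c_def d_def e_def commutator_def m_assoc cancel)
  finally have "word_value G a b ?w = \<one>" .
  moreover have "reduced_word ?w" by (simp add: reduced_word_simps)
  ultimately show False using free unfolding free_generators_def by blast
qed

lemma lift_with_nonneg_trace:
  assumes "X \<in> carrier PSL2R"
  obtains M where "det M = 1" "X = to_PSL2R M" "trace M \<ge> 0"
proof -
  obtain M where M: "det M = 1" "X = to_PSL2R M" using assms by (rule PSL2R_cases)
  show thesis
  proof (cases "trace M \<ge> 0")
    case False
    then have "trace (- M) \<ge> 0" by (simp add: trace_def sum_2)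
    then show thesis using M that[of "- M"] by (simp add: det_uminus2 to_PSL2R_eq insert_commute)
  qed (use M that in blast)
qed

theorem lemma3p2:
  fixes G :: "('g, 'm) monoid_scheme" and a b :: 'g
    and p :: "complex \<Rightarrow> complex \<times> complex" and \<rho> :: "'g \<Rightarrow> (real^2^2) set"
  assumes "teichmueller_punctured_torus G a b p \<rho>"
    and "Tr \<rho> a = Tr \<rho> b"
    and "Tr \<rho> (a [^]\<^bsub>G\<^esub> (2::nat)) = Tr \<rho> (a [^]\<^bsub>G\<^esub> (2::nat) \<otimes>\<^bsub>G\<^esub> b)"
  shows "\<not> arithmetic (\<rho> ` carrier G)"
proof
  assume ar: "arithmetic (\<rho> ` carrier G)"
  have free: "free_generators G a b" and hom: "\<rho> \<in> hom G PSL2R" and inj: "inj_on \<rho> (carrier G)"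
    and sub: "subgroup (\<rho> ` carrier G) PSL2R" and par: "parabolic (\<rho> (commutator G a b))"
    using assms(1) by (simp_all add: teichmueller_punctured_torus_def hyperbolic_uniformization_def)
  interpret group G using free by (simp add: free_generators_def)
  interpret \<rho>: group_hom G PSL2R \<rho>
    using hom by (simp add: group_hom_def group_hom_axioms_def group_PSL2R group_axioms)
  have ab [simp]: "a \<in> carrier G" "b \<in> carrier G" using free by (simp_all add: free_generators_def)
  obtain A where A: "det A = 1" "\<rho> a = to_PSL2R A" "trace A \<ge> 0"
    using \<rho>.hom_closed[OF ab(1)] by (rule lift_with_nonneg_trace)
  obtain B where B: "det B = 1" "\<rho> b = to_PSL2R B" "trace B \<ge> 0"
    using \<rho>.hom_closed[OF ab(2)] by (rule lift_with_nonneg_trace)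
  note lift_simps = det_mul det_adj2 A(1,2) B(1,2) to_PSL2R_mult to_PSL2R_inv
  define C where "C = A ** B ** adj2 A ** adj2 B"
  have detC: "det C = 1" by (simp add: C_def lift_simps)
  have \<rho>c: "\<rho> (commutator G a b) = to_PSL2R C"
    by (simp add: commutator_def C_def lift_simps)
  \<comment> \<open>Parabolicity determines the trace only up to sign; faithfulness of \<rho> on the
    free group decides the sign.\<close>
  have "trace C \<noteq> 2"
  proof
    assume "trace C = 2"
    then have comm: "C ** (A ** C ** adj2 A) = (A ** C ** adj2 A) ** C"
      unfolding C_def by (rule commutator_commutes_with_conjugate[OF A(1) B(1)])
    define c where "c = commutator G a b"
    define d where "d = a \<otimes>\<^bsub>G\<^esub> c \<otimes>\<^bsub>G\<^esub> inv\<^bsub>G\<^esub> a"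
    have cd: "c \<in> carrier G" "d \<in> carrier G" by (simp_all add: c_def d_def commutator_def)
    have c: "\<rho> c = to_PSL2R C" using \<rho>c by (simp add: c_def)
    then have d: "\<rho> d = to_PSL2R (A ** C ** adj2 A)"
      using cd by (simp add: d_def lift_simps detC)
    have "\<rho> (c \<otimes>\<^bsub>G\<^esub> d) = to_PSL2R (C ** (A ** C ** adj2 A))"
      using cd c d by (simp add: lift_simps detC)
    also have "\<dots> = \<rho> (d \<otimes>\<^bsub>G\<^esub> c)"
      unfolding comm using cd c d by (simp add: lift_simps detC)
    finally have "c \<otimes>\<^bsub>G\<^esub> d = d \<otimes>\<^bsub>G\<^esub> c"
      by (rule inj_onD[OF inj]) (use cd in simp_all)
    then show False
      using free_generators_commutator[OF free] by (simp add: c_def d_def)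
  qed
  moreover have "\<bar>trace C\<bar> = 2"
    using par \<rho>c by (simp add: parabolic_def to_PSL2R_eq)
  ultimately have trC: "trace C = -2" by linarith
  define x where "x = trace A"
  define y where "y = trace B"
  define z where "z = trace (A ** B)"
  have markov: "x\<^sup>2 + y\<^sup>2 + z\<^sup>2 = x * y * z"
    using trace_commutator[OF A(1) B(1)] trC by (simp add: C_def x_def y_def z_def)
  have "x \<noteq> 0"
  proof
    assume "x = 0"
    then have "A ** A = - mat 1"
      using A(1) cayley_hamilton2[of A] by (simp add: x_def)
    then have "\<rho> (a \<otimes>\<^bsub>G\<^esub> a) = \<rho> \<one>\<^bsub>G\<^esub>"
      by (simp add: lift_simps flip: to_PSL2R_mult) (simp add: to_PSL2R_one to_PSL2R_eq_iff)
    then have "a \<otimes>\<^bsub>G\<^esub> a = \<one>\<^bsub>G\<^esub>" by (rule inj_onD[OF inj]) simp_all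
    then show False using free_generators_square[OF free] by simp
  qed
  moreover have "y \<noteq> 0" "z \<noteq> 0"
  proof -
    have "x\<^sup>2 > 0" using \<open>x \<noteq> 0\<close> by simp
    then have "x * y * z \<noteq> 0"
      using markov zero_le_power2[of y] zero_le_power2[of z] by linarith
    then show "y \<noteq> 0" "z \<noteq> 0" by auto
  qed
  ultimately have x2: "x > 2" and y2: "y > 2" and az2: "\<bar>z\<bar> > 2"
    using markov_solution_gt_2[of x y z] markov_solution_gt_2[of y x z] markov_solution_gt_2[of z x y]
      markov A(3) B(3) by (simp_all add: x_def y_def mult.commute mult.left_commute add.commute add.left_commute)
  \<comment> \<open>The signs of \<open>x\<close> and \<open>y\<close> were fixed by choosing lifts,
    which leaves no freedom for \<open>z\<close>; its sign comes from the Markov equation.\<close>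
  have "x\<^sup>2 > 0" using x2 by simp
  then have "x * y * z > 0"
    using markov zero_le_power2[of y] zero_le_power2[of z] by linarith
  moreover have "x * y > 0" using x2 y2 by simp
  ultimately have "z > 0" by (rule zero_less_mult_pos)
  then have z2: "z > 2" using az2 by simp
  have xy: "x = y"
    using assms(2) Tr_eq_trace[OF A(1), of \<rho> a] Tr_eq_trace[OF B(1), of \<rho> b] A(2) B(2) x2 y2
    by (simp add: x_def y_def)
  have x4: "x\<^sup>2 > 4" using x2 power_strict_mono[of 2 x 2] by simp
  have a2: "a [^]\<^bsub>G\<^esub> (2::nat) = a \<otimes>\<^bsub>G\<^esub> a" by (simp add: numeral_2_eq_2)
  have "trace (A ** A) = x\<^sup>2 - 2 * det A"
    by (simp add: x_def mat2_simps power2_eq_square algebra_simps)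
  then have tAA: "trace (A ** A) = x\<^sup>2 - 2"
    using A(1) by simp
  have "trace (A ** A ** B) = x * z - det A * y"
    by (simp add: x_def y_def z_def mat2_simps algebra_simps)
  then have tAAB: "trace (A ** A ** B) = x * (z - 1)"
    using A(1) xy by (simp add: algebra_simps)
  have "x * (z - 1) > 2 * 1"
    using x2 z2 by (intro mult_strict_mono) auto
  \<comment> \<open>Both sides exceed 2, so \<open>Tr\<close> agrees with the trace for
    \<open>A ** A\<close> and \<open>A ** A ** B\<close>, and the absolute values disappear.\<close>
  then have tr_eq: "x\<^sup>2 - 2 = x * (z - 1)"
    using assms(3) Tr_eq_trace[of "A ** A" \<rho> "a \<otimes>\<^bsub>G\<^esub> a"]
      Tr_eq_trace[of "A ** A ** B" \<rho> "a \<otimes>\<^bsub>G\<^esub> a \<otimes>\<^bsub>G\<^esub> b"] x4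
    unfolding a2 tAA tAAB by (simp add: lift_simps)
  have "commutator G a b \<in> carrier G" by (simp add: commutator_def)
  then have "\<rho> (commutator G a b) \<in> \<rho> ` carrier G" by (rule imageI)
  then obtain \<A> where alg: "rational_matrix_algebra \<A>"
    and pow: "\<And>M. det M = 1 \<Longrightarrow> to_PSL2R M \<in> \<rho> ` carrier G \<Longrightarrow> \<exists>n>0. M [^]\<^bsub>SL2R\<^esub> (n::nat) \<in> \<A>"
    using arithmetic_with_parabolic[OF ar sub _ par] by blast
  \<comment> \<open>A power of \<open>M\<close> lies in the algebra, and \<open>M\<close> is
    recovered from it up to scaling and adding a scalar matrix.\<close>
  have line: "\<exists>U\<in>\<A>. \<exists>r r'. M = r *\<^sub>R U + r' *\<^sub>R mat 1"
    if M: "det M = 1" "\<bar>trace M\<bar> > 2" and g: "g \<in> carrier G" "\<rho> g = to_PSL2R M" for M g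
  proof -
    have "to_PSL2R M \<in> \<rho> ` carrier G" using g by (metis imageI)
    from pow[OF M(1) this] obtain n where n: "n > 0" "M [^]\<^bsub>SL2R\<^esub> (n::nat) \<in> \<A>" by blast
    from pow_in_pencil[OF M n(1)] n(2) show ?thesis by (rule bexI)
  qed
  obtain U r r' where U: "U \<in> \<A>" "A = r *\<^sub>R U + r' *\<^sub>R mat 1"
    using line[OF A(1) _ ab(1) A(2)] x2 by (auto simp: x_def)
  obtain V s s' where V: "V \<in> \<A>" "B = s *\<^sub>R V + s' *\<^sub>R mat 1"
    using line[OF B(1) _ ab(2) B(2)] y2 by (auto simp: y_def)
  obtain W t t' where W: "W \<in> \<A>" "A ** B = t *\<^sub>R W + t' *\<^sub>R mat 1"
    using line[of "A ** B" "a \<otimes>\<^bsub>G\<^esub> b"] z2 by (auto simp: z_def lift_simps)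
  have "det (A ** B - B ** A) \<noteq> 0"
    using det_matrix_commutator[OF A(1) B(1)] trC by (simp add: C_def)
  from rational_traces_of_lines[OF alg U(1) V(1) W(1) A(1) B(1) this U(2) V(2) W(2)]
  have rat: "x\<^sup>2 \<in> \<rat>" "x\<^sup>2 * z \<in> \<rat>"
    using xy by (simp_all add: x_def y_def z_def power2_eq_square)
  \<comment> \<open>Rationality passes from \<open>x\<close> squared and \<open>x\<close> squared
    times \<open>z\<close> to \<open>z\<close>, and then to \<open>x\<close> through the second
    length equation.\<close>
  have "z = (x\<^sup>2 * z) / x\<^sup>2" using x2 by simp
  then have "z \<in> \<rat>" using rat by (metis Rats_divide)
  moreover have "x = (x\<^sup>2 - 2) / (z - 1)" using tr_eq z2 by (simp add: field_simps)
  ultimately have "x \<in> \<rat>" using rat(1) by (metis Rats_diff Rats_divide Rats_1 Rats_number_of)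
  moreover have "x ^ 5 - 2 * x ^ 4 - 4 * x ^ 3 + 3 * x\<^sup>2 + 4 * x - 4 = 0"
  proof -
    have zx: "x * z = x\<^sup>2 + x - 2" using tr_eq by (simp add: algebra_simps)
    \<comment> \<open>Multiplied by the square of \<open>x\<close>, the Markov equation involves
      \<open>z\<close> only through \<open>x * z\<close>, which the length condition expresses in
      \<open>x\<close>.\<close>
    have "2 * x ^ 4 + (x * z)\<^sup>2 = x ^ 3 * (x * z)"
      using arg_cong[OF markov, of "\<lambda>t. x\<^sup>2 * t"] unfolding xy[symmetric]
      by (simp add: eval_nat_numeral algebra_simps)
    then show ?thesis unfolding zx by (simp add: eval_nat_numeral algebra_simps)
  qed
  ultimately show False using quintic_no_rational_root x2 by blast
qed

end
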